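(* Given an integer $d\ge4$, there exists an integral convex polytope $\mathcal{P}$ of dimension $d$ such that $\mu_{\mathrm{Hilb}}(\mathcal{P})=d-1$ and $\mu_{\mathrm{midp}}(\mathcal{P})=\mu_{\mathrm{idp}}(\mathcal{P})=d-2$.
   Context: An integral convex polytope is a convex polytope whose vertices lie in $\mathbb{Z}^N$; $k\mathcal{P}=\{k\alpha:\alpha\in\mathcal{P}\}$. A polytope $\mathcal{Q}$ has the integer decomposition property (IDP) if for every integer $k\ge1$ and every $\alpha\in k\mathcal{Q}\cap\mathbb{Z}^N$ there are $\alpha_1,\dots,\alpha_k\in\mathcal{Q}\cap\mathbb{Z}^N$ with $\alpha=\alpha_1+\cdots+\alpha_k$. $\mu_{\mathrm{midp}}(\mathcal{P})$ is the smallest $k>0$ such that $k\mathcal{P}$ has IDP; $\mu_{\mathrm{idp}}(\mathcal{P})$ is the smallest $k>0$ such that $n\mathcal{P}$ has IDP for all $n\ge k$. Let $\mathcal{C}(\mathcal{P})\subset\mathbb{R}^{N+1}$ be the cone generated by $\{(v,1): v \text{ a vertex of }\mathcal{P}\}$, with the degree of $(\alpha,n)$ being $n$; $\mu_{\mathrm{Hilb}}(\mathcal{P})$ is the maximal degree of an element of the (unique) minimal Hilbert basis of $\mathcal{C}(\mathcal{P})$. *)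

theory Defs
  imports "HOL-Analysis.Analysis"
begin

definition lattice_pts :: "(real^'n) set" where
  "lattice_pts = {x. \<forall>i. x $ i \<in> \<int>}"

definition integral_polytope :: "(real^'n) set \<Rightarrow> bool" where
  "integral_polytope P \<longleftrightarrow>
     (\<exists>V. finite V \<and> V \<subseteq> lattice_pts \<and> P = convex hull V)"

definition dilate :: "nat \<Rightarrow> (real^'n) set \<Rightarrow> (real^'n) set" where
  "dilate k Q = (\<lambda>x. real k *\<^sub>R x) ` Q"

definition IDP :: "(real^'n) set \<Rightarrow> bool" where
  "IDP Q \<longleftrightarrow> (\<forall>k::nat. k \<ge> 1 \<longrightarrow>
     (\<forall>\<alpha> \<in> dilate k Q \<inter> lattice_pts.
        \<exists>a :: nat \<Rightarrow> real^'n. (\<forall>j<k. a j \<in> Q \<inter> lattice_pts) \<and> \<alpha> = (\<Sum>j<k. a j)))"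

definition mu_midp :: "(real^'n) set \<Rightarrow> nat" where
  "mu_midp P = (LEAST k. k > 0 \<and> IDP (dilate k P))"

definition mu_idp :: "(real^'n) set \<Rightarrow> nat" where
  "mu_idp P = (LEAST k. k > 0 \<and> (\<forall>n\<ge>k. IDP (dilate n P)))"

text \<open>The cone C(P) in R^(N+1) = R^N x R generated by (v,1), v a vertex of P;
  degree of (alpha, n) is n.\<close>
definition cone_of :: "(real^'n) set \<Rightarrow> ((real^'n) \<times> real) set" where
  "cone_of P = convex_cone hull {(v, 1) | v. v extreme_point_of P}"

definition lattice_pts1 :: "((real^'n) \<times> real) set" where
  "lattice_pts1 = {(x, t). x \<in> lattice_pts \<and> t \<in> \<int>}"

definition hilbert_basis :: "((real^'n) \<times> real) set \<Rightarrow> ((real^'n) \<times> real) set \<Rightarrow> bool" where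
  "hilbert_basis C H \<longleftrightarrow> finite H \<and> H \<subseteq> C \<inter> lattice_pts1 \<and>
     (\<forall>z \<in> C \<inter> lattice_pts1. \<exists>c :: ((real^'n) \<times> real) \<Rightarrow> nat. z = (\<Sum>h\<in>H. real (c h) *\<^sub>R h))"

definition minimal_hilbert_basis :: "((real^'n) \<times> real) set \<Rightarrow> ((real^'n) \<times> real) set \<Rightarrow> bool" where
  "minimal_hilbert_basis C H \<longleftrightarrow> hilbert_basis C H \<and> (\<forall>H'. H' \<subset> H \<longrightarrow> \<not> hilbert_basis C H')"

text \<open>Maximal degree of an element of the (unique) minimal Hilbert basis of C(P).\<close>
definition mu_Hilb :: "(real^'n) set \<Rightarrow> real" where
  "mu_Hilb P = Max (snd ` (THE H. minimal_hilbert_basis (cone_of P) H))"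

end

theory Submission
  imports Defs "HOL-Number_Theory.Cong"
begin

text \<open>
  The polytope is a prism over a \<open>(d - 1)\<close>-dimensional lattice simplex, taken in a sheared lattice. At
  height \<open>0\<close> the lattice of the base simplex has cyclic quotient of order \<open>p\<close> by the lattice of
  its vertices, with weights \<open>\<alpha> i\<close>; going up by one unit translates it by \<open>- T\<close> in barycentric
  coordinates, where the \<open>T i\<close> are positive with sum \<open>1\<close>. So \<open>1 - T\<close> is a lattice point of degree
  \<open>d - 1\<close> at height \<open>1\<close>. The weights are such that the sets of classes \<open>g\<close> whose coordinate \<open>i\<close> exceeds
  \<open>1 - T i\<close> tile the nonzero classes; hence no class of height \<open>0\<close> fits below \<open>1 - T\<close>, and this point
  is irreducible. Every tile is nonempty, so after adding any vertex some class does fit, and the sum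
  splits into parts of degrees in \<open>[2, d - 2]\<close>. For every other point of degree \<open>d - 1\<close> without
  coordinate \<open>\<ge> 1\<close>, a pigeonhole count over the classes at a suitable height finds one that fits below
  it. So every point of degree \<open>d\<close> splits into parts of degrees in \<open>[2, d - 2]\<close>; as points of degree
  \<open>\<ge> d\<close> have a vertex as summand, this yields IDP for all multiples from \<open>d - 2\<close> on. Finally, the shear
  is tuned so that one side facet has an irreducible point of degree \<open>d - 2\<close> at its first height above
  the base, which excludes IDP for the smaller multiples.
\<close>

subsection \<open>Choice of the parameters\<close>

text \<open>This sum is the elementary symmetric polynomial of degree \<open>m - 1\<close>, the
  numerator of the sum of the \<open>1 / Q k\<close>. Its residue is used to show that the
  numerator, divided by \<open>m\<close>, is coprime to \<open>n\<close>.\<close>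

lemma sum_prod_others_cong:
  fixes Q :: "nat \<Rightarrow> int"
  assumes "\<And>k. k < m \<Longrightarrow> [Q k = a] (mod n)"
  shows "[(\<Sum>j<m. \<Prod>k\<in>{..<m} - {j}. Q k) = int m * a ^ (m - 1)] (mod n)"
proof -
  have "[(\<Prod>k\<in>{..<m} - {j}. Q k) = a ^ (m - 1)] (mod n)" if "j < m" for j
  proof -
    have "[(\<Prod>k\<in>{..<m} - {j}. Q k) = (\<Prod>k\<in>{..<m} - {j}. a)] (mod n)"
      using assms by (intro cong_prod) auto
    then show ?thesis using that by (simp add: card_Diff_singleton)
  qed
  then have "[(\<Sum>j<m. \<Prod>k\<in>{..<m} - {j}. Q k) = (\<Sum>j<m. a ^ (m - 1))] (mod n)"
    by (intro cong_sum) auto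
  then show ?thesis by simp
qed

lemma not_coprime_int_prime:
  fixes a b :: int
  assumes "\<not> coprime a b"
  obtains q where "prime q" "q dvd a" "q dvd b"
proof -
  have "\<not> is_unit (gcd a b)" using assms by (simp add: coprime_iff_gcd_eq_1)
  then obtain q where "prime q" "q dvd gcd a b" 
    using prime_factor_int[of "gcd a b"] by (metis abs_gcd_int is_unit_gcd zdvd1_eq)
  then show thesis using that by auto
qed

text \<open>A prime dividing \<open>p\<close> and \<open>Q j\<close> divides every term containing
  \<open>Q j\<close>, hence also the single term omitting it, hence some other \<open>Q k\<close>,
  and so a difference \<open>Q k - Q j\<close>.\<close>

lemma sum_prod_others_coprime:
  fixes Q :: "nat \<Rightarrow> int"
  assumes "p dvd (\<Sum>j<m. \<Prod>k\<in>{..<m} - {j}. Q k)"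
    and "\<And>q k j. prime q \<Longrightarrow> q dvd p \<Longrightarrow> k < m \<Longrightarrow> j < m \<Longrightarrow> k \<noteq> j \<Longrightarrow> \<not> q dvd Q k - Q j"
    and "j < m"
  shows "coprime (Q j) p"
proof (rule ccontr)
  assume "\<not> ?thesis"
  then obtain q where q: "prime q" "q dvd Q j" "q dvd p"
    by (rule not_coprime_int_prime)
  have "(\<Sum>i<m. \<Prod>k\<in>{..<m} - {i}. Q k)
      = (\<Prod>k\<in>{..<m} - {j}. Q k) + (\<Sum>i\<in>{..<m} - {j}. \<Prod>k\<in>{..<m} - {i}. Q k)"
    using \<open>j < m\<close> by (simp add: sum.remove)
  moreover have "q dvd (\<Sum>i\<in>{..<m} - {j}. \<Prod>k\<in>{..<m} - {i}. Q k)"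
  proof (rule dvd_sum)
    fix i assume "i \<in> {..<m} - {j}"
    then have "Q j dvd (\<Prod>k\<in>{..<m} - {i}. Q k)"
      using \<open>j < m\<close> by (intro dvd_prodI) auto
    then show "q dvd (\<Prod>k\<in>{..<m} - {i}. Q k)" using q by (meson dvd_trans)
  qed
  moreover have "q dvd (\<Sum>i<m. \<Prod>k\<in>{..<m} - {i}. Q k)"
    using assms(1) q by (meson dvd_trans)
  ultimately have "q dvd (\<Prod>k\<in>{..<m} - {j}. Q k)"
    by (simp add: dvd_add_left_iff)
  then obtain k where "k < m" "k \<noteq> j" "q dvd Q k"
    using q by (subst (asm) prime_dvd_prod_iff) auto
  then show False using assms(2)[OF q(1,3), of k j] q \<open>j < m\<close> by (simp add: dvd_diff)
qed

text \<open>Multiplication by the product of all \<open>Q k\<close>, a unit modulo \<open>p\<close>,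
  turns the sum of the inverses into the numerator.\<close>

lemma sum_inverses_dvd:
  fixes Q y :: "nat \<Rightarrow> int"
  assumes "p dvd (\<Sum>j<m. \<Prod>k\<in>{..<m} - {j}. Q k)"
    and "\<And>j. j < m \<Longrightarrow> coprime (Q j) p"
    and "\<And>j. j < m \<Longrightarrow> [Q j * y j = 1] (mod p)"
  shows "p dvd (\<Sum>j<m. y j)"
proof -
  have "[(\<Prod>k<m. Q k) * (\<Sum>j<m. y j) = (\<Sum>j<m. \<Prod>k\<in>{..<m} - {j}. Q k)] (mod p)"
    unfolding sum_distrib_left
  proof (rule cong_sum)
    fix j assume "j \<in> {..<m}"
    then have "(\<Prod>k<m. Q k) * y j = (\<Prod>k\<in>{..<m} - {j}. Q k) * (Q j * y j)"
      by (simp add: prod.remove mult_ac)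
    then show "[(\<Prod>k<m. Q k) * y j = (\<Prod>k\<in>{..<m} - {j}. Q k)] (mod p)"
      using assms(3)[of j] \<open>j \<in> {..<m}\<close>
      by (metis cong_scalar_left lessThan_iff mult.right_neutral)
  qed
  then have "p dvd (\<Prod>k<m. Q k) * (\<Sum>j<m. y j)"
    using assms(1) cong_dvd_iff cong_sym by blast
  moreover have "coprime (\<Prod>k<m. Q k) p"
    using assms(2) by (intro prod_coprime_left) auto
  ultimately show ?thesis
    by (simp add: coprime_commute coprime_dvd_mult_right_iff)
qed

text \<open>For \<open>d \<ge> 5\<close>, \<open>s\<close> is chosen as \<open>- (t + 1) / (d * t)\<close> modulo \<open>p\<close>, which gives \<open>p dvd (d * s + 1) * t + 1\<close>
  and turns \<open>1 / (s + 1 + j)\<close> into a multiple of \<open>1 / Q j\<close> for explicit integers \<open>Q j\<close>; then \<open>p\<close> is the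
  numerator of the sum of the \<open>1 / Q j\<close>, up to the factor \<open>d - 2\<close>.\<close>

lemma prism_parameters_exist:
  fixes d :: nat
  assumes "d \<ge> 4"
  obtains p s t r :: int and \<beta> :: "nat \<Rightarrow> int"
  where "1 \<le> s" "s + int d \<le> p" "1 \<le> t" "0 \<le> r" "int d * r < t"
    "\<forall>j<d - 2. p dvd \<beta> j * (s + 1 + int j) + 1"
    "p dvd (\<Sum>j<d - 2. \<beta> j)"
    "d \<ge> 5 \<longrightarrow> p dvd (int d * s + 1) * t + r \<and>
       coprime ((int d * s + 1) * t + r) (int d * t) \<and> (int d - 2) * (int d + 1) * t < p"
proof (cases "d = 4")
  case True
  \<comment> \<open>Modulo 5 with \<open>s = 1\<close>: 2 * 2 + 1 = 5, 3 * 3 + 1 = 10 and 2 + 3 =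
    5.\<close>
  show ?thesis
    by (rule that[of 1 5 1 0 "\<lambda>j. 2 + int j"]) (use True in \<open>auto simp: numeral_2_eq_2 less_Suc_eq\<close>)
next
  case False
  then have d5: "d \<ge> 5" using assms by simp
  define m where "m = d - 2"
  have m3: "m \<ge> 3" and dm: "d = m + 2" using d5 by (auto simp: m_def)
  define f :: int where "f = fact d"
  \<comment> \<open>The square leaves a factor \<open>f\<close> in \<open>n'\<close> below after the
    division by \<open>m\<close>, so every prime divisor of \<open>n\<close> still divides
    \<open>n'\<close>.\<close>
  define t where "t = f ^ 2"
  define n where "n = int d * t"
  define \<nu> where "\<nu> = t + 1"
  \<comment> \<open>Once \<open>n * s\<close> is \<open>- \<nu>\<close> modulo \<open>p\<close>,
    \<open>Q j\<close> is congruent to \<open>n * (s + 1 + int j)\<close>.\<close>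
  define Q where "Q = (\<lambda>j::nat. n * (int j + 1) - \<nu>)"
  define R where "R = (\<Sum>j<m. \<Prod>k\<in>{..<m} - {j}. Q k)"
  have f_ge: "int d \<le> f" unfolding f_def by (metis fact_ge_self of_nat_fact of_nat_le_iff)
  have dvd_f: "int k dvd f" if "1 \<le> k" "k \<le> d" for k
    using that unfolding f_def by (metis dvd_fact of_nat_dvd_iff of_nat_fact)
  have "int d * 5 \<le> f * f" using f_ge d5 by (intro mult_mono) auto
  then have t_ge: "t \<ge> 5 * int d" by (simp add: t_def power2_eq_square)
  have n_t: "n \<ge> 5 * t" unfolding n_def using d5 t_ge by (intro mult_right_mono) auto
  have md: "int m dvd f" using m3 dm by (intro dvd_f) auto
  have R_cong: "[R = int m * (- \<nu>) ^ (m - 1)] (mod n)"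
    unfolding R_def
    by (rule sum_prod_others_cong) (simp add: Q_def cong_iff_dvd_diff)
  then obtain z where z: "R = int m * (- \<nu>) ^ (m - 1) + n * z"
    by (metis cong_iff_lin cong_sym)
  define n' where "n' = int d * f * (f div int m)"
  have n_n': "n = int m * n'" using md by (simp add: n_def n'_def t_def power2_eq_square)
  \<comment> \<open>\<open>R\<close> divided by \<open>m\<close>, in a form that shows its residue
    modulo the primes dividing \<open>n\<close>.\<close>
  define p where "p = (- \<nu>) ^ (m - 1) + n' * z"
  have R_p: "R = int m * p" unfolding p_def z n_n' by (simp add: algebra_simps)
  have n_primes: "q dvd f" if "prime q" "q dvd n" for q
  proof -
    have "q dvd int d \<or> q dvd f"
      using that by (auto simp: n_def t_def prime_dvd_mult_iff prime_dvd_power_iff)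
    then show ?thesis using dvd_f[of d] d5 by (meson dvd_trans le_refl order.trans one_le_numeral)
  qed
  \<comment> \<open>A common prime would divide both \<open>t\<close> and
    \<open>\<nu> = t + 1\<close>.\<close>
  have cop_pn: "coprime p n"
  proof (rule ccontr)
    assume "\<not> ?thesis"
    then obtain q where q: "prime q" "q dvd p" "q dvd n" by (rule not_coprime_int_prime)
    have "q dvd f" using n_primes q by auto
    then have "q dvd n'" "q dvd t" by (auto simp: n'_def t_def power2_eq_square)
    then have "q dvd (- \<nu>) ^ (m - 1)" using q(2) by (simp add: p_def dvd_add_left_iff)
    then have "q dvd \<nu>" using q(1) by (metis dvd_minus_iff prime_dvd_power)
    then have "q dvd 1" using \<open>q dvd t\<close> by (simp add: \<nu>_def dvd_add_right_iff)
    then show False using q(1) by auto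
  qed
  have cop_Q: "coprime (Q j) p" if "j < m" for j
  proof (rule sum_prod_others_coprime[where m = m])
    show "p dvd (\<Sum>j<m. \<Prod>k\<in>{..<m} - {j}. Q k)" using R_p by (simp add: R_def)
    fix q k j assume q: "prime q" "q dvd p" and kj: "k < m" "j < m" "k \<noteq> j"
    \<comment> \<open>The difference is \<open>n * (int k - int j)\<close>, and the distance of
      \<open>k\<close> and \<open>j\<close> divides \<open>f\<close>, hence \<open>n\<close>. So
      \<open>q\<close> would divide \<open>n\<close>.\<close>
    have qn: "\<not> q dvd n" using q cop_pn by (meson coprime_common_divisor not_prime_unit)
    show "\<not> q dvd Q k - Q j"
    proof
      assume "q dvd Q k - Q j"
      then have "q dvd n * (int k - int j)" by (simp add: Q_def algebra_simps)
      then have "q dvd (int k - int j)" using q(1) qn by (simp add: prime_dvd_mult_iff)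
      then have "q dvd int (nat \<bar>int k - int j\<bar>)" by simp
      moreover have "int (nat \<bar>int k - int j\<bar>) dvd f" using kj dm by (intro dvd_f) auto
      moreover have "f dvd n" by (simp add: n_def t_def power2_eq_square)
      ultimately show False using qn by (meson dvd_trans)
    qed
  qed (fact that)
  have Q_pos: "Q j \<ge> 1" for j
  proof -
    have "n * 1 \<le> n * (int j + 1)" using n_t t_ge by (intro mult_left_mono) auto
    then show ?thesis using n_t t_ge d5 unfolding Q_def \<nu>_def by linarith
  qed
  then have Q_nonneg: "Q j \<ge> 0" for j by (meson order.trans zero_le_one)
  have Q_big: "Q j \<ge> n" if "j \<ge> 1" for j
  proof -
    have "n * 2 \<le> n * (int j + 1)" using n_t t_ge that by (intro mult_left_mono) auto
    then show ?thesis using n_t t_ge d5 unfolding Q_def \<nu>_def by linarith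
  qed
  \<comment> \<open>As \<open>m \<ge> 3\<close>, the term omitting \<open>Q 0\<close> contains
    \<open>Q 1 * Q 2\<close>; this growth makes \<open>p\<close> exceed
    \<open>n * int d\<close>.\<close>
  have "n * n \<le> R"
  proof -
    have "n * n \<le> Q 1 * Q 2" using Q_big[of 1, OF order.refl] Q_big[of 2, OF one_le_numeral] Q_pos[of 1] n_t t_ge
      by (intro mult_mono) linarith+
    also have "\<dots> = (\<Prod>k\<in>{1,2}. Q k)" by simp
    also have "\<dots> \<le> (\<Prod>k\<in>{..<m} - {0}. Q k)"
      using m3 Q_pos Q_nonneg by (intro prod_mono2) auto
    also have "\<dots> \<le> R"
      unfolding R_def using m3 Q_nonneg
      by (intro member_le_sum[of 0 "{..<m}" "\<lambda>j. \<Prod>k\<in>{..<m} - {j}. Q k"])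
        (auto intro: prod_nonneg)
    finally show ?thesis .
  qed
  have p_big: "p > n * int d"
  proof (rule ccontr)
    assume "\<not> ?thesis"
    then have "int m * p \<le> int m * (n * int d)" by (intro mult_left_mono) auto
    then have "n * n \<le> n * (int m * int d)" using \<open>n * n \<le> R\<close> R_p by (simp add: mult_ac)
    then have "n \<le> int m * int d" using n_t t_ge d5 by (simp add: mult_le_cancel_left)
    moreover have "int m * int d < t * int d" using t_ge dm by (intro mult_strict_right_mono) auto
    ultimately show False by (simp add: n_def mult.commute)
  qed
  obtain x where x: "[n * x = 1] (mod p)"
    using cop_pn by (metis cong_solve_coprime_int coprime_commute)
  define s where "s = (- \<nu> * x) mod p"
  have "n * 1 \<le> n * int d" using n_t t_ge d5 by (intro mult_left_mono) auto
  then have p0: "p > 0" "p > n" "p > \<nu>" using p_big n_t t_ge d5 unfolding \<nu>_def by linarith+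
  have s_bounds: "0 \<le> s" "s < p" using p0 by (auto simp: s_def)
  have "[n * s = n * (- \<nu> * x)] (mod p)" by (simp add: s_def cong_def mod_mult_right_eq)
  also have "n * (- \<nu> * x) = - \<nu> * (n * x)" by simp
  also have "[- \<nu> * (n * x) = - \<nu> * 1] (mod p)" using x by (rule cong_scalar_left)
  finally have ns: "p dvd n * s + \<nu>" by (simp add: cong_iff_dvd_diff)
  define y where "y = (\<lambda>j. SOME y. [Q j * y = 1] (mod p))"
  have y: "[Q j * y j = 1] (mod p)" if "j < m" for j
    unfolding y_def by (rule someI_ex[OF cong_solve_coprime_int[OF cop_Q[OF that]]])
  have y_sum: "p dvd (\<Sum>j<m. y j)"
    by (rule sum_inverses_dvd[of p Q m]) (simp_all add: cop_Q y R_p flip: R_def)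
  show ?thesis
  proof (rule that[of s p t 1 "\<lambda>j. - n * y j"])
    show "1 \<le> s"
    proof (rule ccontr)
      assume "\<not> ?thesis"
      then have "s = 0" using s_bounds by simp
      then have "p dvd \<nu>" using ns by simp
      then show False using p0 t_ge zdvd_imp_le[of p \<nu>] unfolding \<nu>_def by linarith
    qed
    \<comment> \<open>Otherwise \<open>n * (p - s) - \<nu>\<close> would be a positive multiple of
      \<open>p\<close> smaller than \<open>p\<close>.\<close>
    show "s + int d \<le> p"
    proof (rule ccontr)
      assume a: "\<not> ?thesis"
      have eq: "n * (p - s) - \<nu> = n * p - (n * s + \<nu>)" by (simp add: algebra_simps)
      have "p dvd n * (p - s) - \<nu>" unfolding eq using ns by (intro dvd_diff) auto
      moreover have "n * 1 \<le> n * (p - s)" using n_t t_ge s_bounds by (intro mult_left_mono) auto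
      then have "n * (p - s) - \<nu> > 0" using n_t t_ge d5 unfolding \<nu>_def by linarith
      moreover have "n * (p - s) \<le> n * int d" using a n_t t_ge by (intro mult_left_mono) auto
      then have "n * (p - s) - \<nu> < p" using p_big t_ge unfolding \<nu>_def by linarith
      ultimately show False using zdvd_imp_le[of p "n * (p - s) - \<nu>"] by linarith
    qed
    show "1 \<le> t" using t_ge d5 by simp
    show "int d * 1 < t" using t_ge d5 by simp
    have "p dvd - n * y j * (s + 1 + int j) + 1" if "j < d - 2" for j
    proof -
      have "j < m" using that by (simp add: m_def)
      have "- n * y j * (s + 1 + int j) + 1 = (1 - Q j * y j) - y j * (n * s + \<nu>)"
        by (simp add: Q_def algebra_simps)
      moreover have "p dvd 1 - Q j * y j"
        using y[OF \<open>j < m\<close>] by (metis cong_iff_dvd_diff cong_sym)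
      ultimately show ?thesis using ns by (simp only: dvd_diff dvd_mult)
    qed
    then show "\<forall>j<d - 2. p dvd - n * y j * (s + 1 + int j) + 1" by blast
    have "(\<Sum>j<m. - n * y j) = - n * (\<Sum>j<m. y j)" by (simp add: sum_distrib_left)
    then show "p dvd (\<Sum>j<d - 2. - n * y j)" using y_sum by (metis dvd_mult m_def)
    \<comment> \<open>The later value of \<open>T ib\<close>: divisible by \<open>p\<close> through
      the choice of \<open>s\<close>, and coprime to \<open>n\<close> because
      \<open>\<nu> = t + 1\<close>.\<close>
    have T: "(int d * s + 1) * t + 1 = n * s + \<nu>" by (simp add: n_def \<nu>_def algebra_simps)
    have "coprime (n * s + \<nu>) n"
    proof (rule ccontr)
      assume "\<not> ?thesis"
      then obtain q where q: "prime q" "q dvd n * s + \<nu>" "q dvd n" by (rule not_coprime_int_prime)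
      then have "q dvd \<nu>" by (simp add: dvd_add_right_iff)
      moreover have "q dvd t" using n_primes q by (auto simp: t_def power2_eq_square)
      ultimately have "q dvd 1" by (simp add: \<nu>_def dvd_add_right_iff)
      then show False using q(1) by auto
    qed
    then have cop: "coprime ((int d * s + 1) * t + 1) (int d * t)" unfolding T by (simp add: n_def)
    have "(int d - 2) * (int d + 1) \<le> int d * int d" by (simp add: algebra_simps)
    then have "(int d - 2) * (int d + 1) * t \<le> int d * int d * t"
      using t_ge by (intro mult_right_mono) auto
    then have "(int d - 2) * (int d + 1) * t < p" using p_big by (simp add: n_def mult_ac)
    then show "5 \<le> d \<longrightarrow> p dvd (int d * s + 1) * t + 1 \<and>
        coprime ((int d * s + 1) * t + 1) (int d * t) \<and> (int d - 2) * (int d + 1) * t < p"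
      using cop ns unfolding T by blast
  qed auto
qed

subsection \<open>The semigroup of the prism\<close>

text \<open>The indices are the \<open>d\<close> vertices of the base. The opposite weights at
  \<open>ia\<close> and \<open>ib\<close> cancel in every class; the other weights are negative
  inverses of consecutive residues, so that their tiles are single classes. The numbers
  \<open>t\<close> and \<open>r\<close> tune the shear.\<close>

locale skew_prism =
  fixes ia ib :: "'n::finite" and pos :: "'n \<Rightarrow> nat" and \<alpha> :: "'n \<Rightarrow> int" and p s t r :: int
  assumes ia_ib: "ia \<noteq> ib" and card4: "4 \<le> CARD('n)"
    and s1: "1 \<le> s" and p_ge: "s + int CARD('n) \<le> p"
    and t1: "1 \<le> t" and r0: "0 \<le> r" and r_t: "int CARD('n) * r < t"
    and alpha_ia: "\<alpha> ia = 1" and alpha_ib: "\<alpha> ib = - 1"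
    and pos_bij: "bij_betw pos (UNIV - {ia, ib}) {..<CARD('n) - 2}"
    and alpha_inv: "\<And>i. i \<noteq> ia \<Longrightarrow> i \<noteq> ib \<Longrightarrow> p dvd \<alpha> i * (s + 1 + int (pos i)) + 1"
    and alpha_sum: "p dvd sum \<alpha> UNIV"
begin

definition d :: nat where "d = CARD('n)"

definition D :: int where "D = int d * t"

definition N :: int where "N = D * p"

text \<open>The sizes of the tiles; they add up to \<open>p - 1\<close>, the number of nonzero
  classes.\<close>

definition c :: "'n \<Rightarrow> int" where
  "c i = (if i = ia then p - s - int d + 1 else if i = ib then s else 1)"

text \<open>The remainders of \<open>T\<close> modulo \<open>D\<close>; they add up to
  \<open>D\<close>, which completes the sum of \<open>T\<close> to \<open>N\<close>. The
  perturbation by \<open>r\<close> serves to adjust \<open>T ib\<close>.\<close>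

definition e :: "'n \<Rightarrow> int" where
  "e i = (if i = ia then t - r else if i = ib then t + r else t)"

definition T :: "'n \<Rightarrow> int" where "T i = D * c i + e i"

text \<open>\<open>S k \<sigma> u\<close> encodes a lattice point of the \<open>k\<close>-th dilate of a prism over a simplex: \<open>\<sigma> i / N\<close> are
  the barycentric coordinates of its projection to the base and \<open>u / N\<close> is its height. The lattice at
  height \<open>0\<close> is generated over the vertices by the vector \<open>\<alpha> / p\<close>, and each unit of \<open>u\<close> shears it by
  \<open>- T / N\<close>.\<close>

definition S :: "nat \<Rightarrow> ('n \<Rightarrow> int) \<Rightarrow> int \<Rightarrow> bool" where
  "S k \<sigma> u \<longleftrightarrow> (\<exists>g. \<forall>i. N dvd \<sigma> i - D * \<alpha> i * g + u * T i) \<and> (\<forall>i. 0 \<le> \<sigma> i) \<and>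
     sum \<sigma> UNIV = N * int k \<and> 0 \<le> u \<and> u \<le> N * int k"

definition decomp :: "nat \<Rightarrow> nat \<Rightarrow> ('n \<Rightarrow> int) \<Rightarrow> int \<Rightarrow> bool" where
  "decomp j k \<sigma> u \<longleftrightarrow> (\<exists>\<sigma>' u'. S j \<sigma>' u' \<and> S k (\<lambda>i. \<sigma> i - \<sigma>' i) (u - u'))"

lemma d4: "4 \<le> d" and p_ge': "s + int d \<le> p" and r_t': "int d * r < t"
  using card4 p_ge r_t by (auto simp: d_def)

lemma p_pos: "0 < p" using p_ge' s1 by simp

lemma r_lt_t: "4 * r < t"
  using r_t' r0 d4 mult_right_mono[of 4 "int d" r] by linarith

lemma D_ge: "4 * t \<le> D"
  unfolding D_def using d4 t1 by (intro mult_right_mono) auto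

lemma D_pos: "0 < D" using D_ge t1 by simp

lemma N_pos: "0 < N" using D_pos p_pos by (simp add: N_def)

lemma e_bounds: "0 < e i" "e i < D"
  using r_lt_t r0 D_ge t1 by (auto simp: e_def)

lemma c_bounds: "1 \<le> c i" "c i < p"
  using p_ge' s1 d4 by (auto simp: c_def)

lemma sum_split:
  fixes f :: "'n \<Rightarrow> int"
  shows "sum f UNIV = f ia + f ib + sum f (UNIV - {ia, ib})"
proof -
  have "sum f UNIV = sum f ({ia, ib} \<union> (UNIV - {ia, ib}))" by (simp add: Un_absorb1)
  also have "\<dots> = sum f {ia, ib} + sum f (UNIV - {ia, ib})" by (rule sum.union_disjoint) auto
  finally show ?thesis using ia_ib by simp
qed

lemma card_singles: "card (UNIV - {ia, ib}) = d - 2"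
  using ia_ib by (simp add: card_Diff_subset d_def)

lemma single_exists: obtains l where "l \<noteq> ia" "l \<noteq> ib"
proof -
  have "UNIV - {ia, ib} \<noteq> {}"
  proof
    assume "UNIV - {ia, ib} = {}"
    then have "card (UNIV - {ia, ib}) = 0" by (simp only: card.empty)
    then show False using card_singles d4 by simp
  qed
  then show thesis using that by blast
qed

lemma int_d2: "int (d - 2) = int d - 2" using d4 by simp

lemma sum_c: "sum c UNIV = p - 1"
proof -
  have "sum c (UNIV - {ia, ib}) = sum (\<lambda>_. 1) (UNIV - {ia, ib})"
    by (rule sum.cong) (auto simp: c_def)
  then show ?thesis using card_singles int_d2 ia_ib by (simp add: sum_split c_def)
qed

lemma sum_e: "sum e UNIV = D"
proof -
  have "sum e (UNIV - {ia, ib}) = sum (\<lambda>_. t) (UNIV - {ia, ib})"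
    by (rule sum.cong) (auto simp: e_def)
  then show ?thesis using card_singles int_d2 ia_ib
    by (simp add: sum_split e_def D_def algebra_simps)
qed

lemma sum_T: "sum T UNIV = N"
proof -
  have "sum T UNIV = D * sum c UNIV + sum e UNIV"
    by (simp add: T_def sum.distrib sum_distrib_left)
  then show ?thesis by (simp add: sum_c sum_e N_def algebra_simps)
qed

lemma T_bounds: "D < T i" "T i < N"
proof -
  have "D * 1 \<le> D * c i" using c_bounds D_pos by (intro mult_left_mono) auto
  then show "D < T i" using e_bounds[of i] unfolding T_def by linarith
  have "D * c i \<le> D * (p - 1)" using c_bounds[of i] D_pos by (intro mult_left_mono) auto
  then show "T i < N" using e_bounds[of i] by (simp add: T_def N_def algebra_simps)
qed

section \<open>The tiling of the nonzero classes modulo \<open>p\<close>\<close>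

lemma alpha_coprime: "coprime (\<alpha> i) p"
proof (cases "i = ia \<or> i = ib")
  case True then show ?thesis using alpha_ia alpha_ib by auto
next
  case False
  then obtain q where "\<alpha> i * (s + 1 + int (pos i)) + 1 = p * q" using alpha_inv by blast
  then have "\<alpha> i * - (s + 1 + int (pos i)) + p * q = 1" by (simp add: algebra_simps)
  then show ?thesis
    by (intro coprimeI) (metis dvd_add dvd_mult2)
qed

lemma p_dvd_alpha: "p dvd \<alpha> i * g \<longleftrightarrow> p dvd g"
  using alpha_coprime[of i] by (simp add: coprime_commute coprime_dvd_mult_right_iff)

text \<open>The sets \<open>{g. \<alpha> i * g mod p \<le> c i}\<close> tile the nonzero residues modulo \<open>p\<close>: two of them
  are the initial and final intervals, the others are the single residues in between.\<close>

lemma tile_iff: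
  assumes "\<not> p dvd g"
  shows "\<alpha> i * g mod p \<le> c i \<longleftrightarrow>
    (if i = ia then g mod p \<le> p - s - int d + 1 else if i = ib then p - s \<le> g mod p
     else g mod p = p - s - 1 - int (pos i))"
proof -
  define \<gamma> where "\<gamma> = g mod p"
  have \<gamma>: "0 < \<gamma>" "\<gamma> < p"
    using assms p_pos pos_mod_bound[of p g] pos_mod_sign[of p g]
    unfolding \<gamma>_def dvd_eq_mod_eq_0 by linarith+
  consider "i = ia" | "i = ib" | "i \<noteq> ia" "i \<noteq> ib" by blast
  then show ?thesis
  proof cases
    case 1 then show ?thesis by (simp add: alpha_ia c_def)
  next
    case 2
    have "\<alpha> ib * g mod p = p - \<gamma>"
      using assms by (simp add: alpha_ib zmod_zminus1_eq_if \<gamma>_def dvd_eq_mod_eq_0)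
    then show ?thesis using 2 ia_ib by (auto simp: c_def \<gamma>_def)
  next
    case 3
    let ?b = "s + 1 + int (pos i)"
    have "pos i < d - 2" using 3 pos_bij by (auto simp: bij_betw_def d_def)
    then have b: "0 < ?b" "?b < p" using s1 p_ge' by auto
    have m0: "0 < \<alpha> i * g mod p"
      using assms p_pos p_dvd_alpha[of i g] pos_mod_sign[of p "\<alpha> i * g"]
      unfolding dvd_eq_mod_eq_0 by linarith
    have "\<alpha> i * g mod p \<le> c i \<longleftrightarrow> \<alpha> i * g mod p = 1" using m0 3 by (auto simp: c_def)
    also have "\<dots> \<longleftrightarrow> p dvd \<alpha> i * g - 1"
      using b by (metis mod_eq_dvd_iff mod_pos_pos_trivial zero_le_one zle_add1_eq_le
        add_pos_pos int_one_le_iff_zero_less order_le_less_trans)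
    also have "\<dots> \<longleftrightarrow> p dvd \<alpha> i * (g + ?b)"
    proof -
      have "\<alpha> i * (g + ?b) = (\<alpha> i * g - 1) + (\<alpha> i * ?b + 1)" by (simp add: algebra_simps)
      then show ?thesis using alpha_inv[OF 3] by (metis dvd_add_left_iff)
    qed
    also have "\<dots> \<longleftrightarrow> p dvd g + ?b" by (rule p_dvd_alpha)
    also have "\<dots> \<longleftrightarrow> p dvd \<gamma> + ?b" unfolding \<gamma>_def by (simp add: dvd_eq_mod_eq_0 mod_add_left_eq)
    also have "\<dots> \<longleftrightarrow> \<gamma> + ?b = p"
    proof
      assume "p dvd \<gamma> + ?b"
      then obtain q where q: "\<gamma> + ?b = p * q" by blast
      then have "p * 0 < p * q" "p * q < p * 2" using \<gamma> b by linarith+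
      then have "0 < q" "q < 2" using p_pos by (metis mult_less_cancel_left_pos)+
      then have "q = 1" by simp
      then show "\<gamma> + ?b = p" using q by simp
    qed simp
    finally show ?thesis using 3 by (auto simp: \<gamma>_def)
  qed
qed

lemma tile_exists:
  assumes "\<not> p dvd g"
  obtains i where "\<alpha> i * g mod p \<le> c i"
proof -
  define \<gamma> where "\<gamma> = g mod p"
  consider "\<gamma> \<le> p - s - int d + 1" | "p - s \<le> \<gamma>" | "p - s - int d + 1 < \<gamma>" "\<gamma> < p - s" by linarith
  then show thesis
  proof cases
    case 1 then show ?thesis using that[of ia] tile_iff[OF assms, of ia] by (simp add: \<gamma>_def)
  next
    case 2 then show ?thesis using that[of ib] tile_iff[OF assms, of ib] ia_ib by (simp add: \<gamma>_def)
  next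
    case 3
    have "nat (p - s - 1 - \<gamma>) \<in> {..<CARD('n) - 2}" using 3 d4 by (auto simp: d_def)
    then obtain i where "i \<noteq> ia" "i \<noteq> ib" "pos i = nat (p - s - 1 - \<gamma>)"
      using pos_bij unfolding bij_betw_def by (metis Diff_iff imageE insert_iff)
    then show ?thesis using that[of i] tile_iff[OF assms, of i] 3 by (simp add: \<gamma>_def)
  qed
qed

lemma tile_unique:
  assumes "\<not> p dvd g" "\<alpha> i * g mod p \<le> c i" "\<alpha> j * g mod p \<le> c j"
  shows "i = j"
proof -
  have pos: "int (pos k) \<le> int d - 3" if "k \<noteq> ia" "k \<noteq> ib" for k
  proof -
    have "pos k < d - 2" using that pos_bij by (auto simp: bij_betw_def d_def)
    then show ?thesis by linarith
  qed
  have inj: "k = l" if "pos k = pos l" "k \<noteq> ia" "k \<noteq> ib" "l \<noteq> ia" "l \<noteq> ib" for k l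
    using that pos_bij by (auto simp: bij_betw_def inj_on_def)
  show ?thesis
    using assms(2,3) pos[of i] pos[of j] inj[of i j] d4
    unfolding tile_iff[OF assms(1)] by (auto split: if_splits)
qed

lemma alpha_mod_compl:
  assumes "\<not> p dvd g"
  shows "\<alpha> i * - g mod p = p - \<alpha> i * g mod p"
  using assms p_dvd_alpha[of i g]
  by (simp add: zmod_zminus1_eq_if dvd_eq_mod_eq_0)

text \<open>The coordinates at \<open>ia\<close> and \<open>ib\<close> add up to exactly
  \<open>p\<close>, and the others are positive. So no nonzero class at height \<open>0\<close> has
  degree one.\<close>

lemma level0_sum_gt:
  assumes "\<not> p dvd g"
  shows "p < (\<Sum>i\<in>UNIV. \<alpha> i * g mod p)"
proof -
  have "1 \<le> \<alpha> i * g mod p" for i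
  proof -
    have "\<alpha> i * g mod p \<noteq> 0" using assms p_dvd_alpha[of i g] by (simp add: dvd_eq_mod_eq_0)
    moreover have "0 \<le> \<alpha> i * g mod p" using p_pos by simp
    ultimately show ?thesis by linarith
  qed
  then have "(\<Sum>i\<in>UNIV - {ia, ib}. 1) \<le> (\<Sum>i\<in>UNIV - {ia, ib}. \<alpha> i * g mod p)"
    by (intro sum_mono) auto
  moreover have "\<alpha> ib * g mod p = p - \<alpha> ia * g mod p"
    using alpha_mod_compl[OF assms, of ia] by (simp add: alpha_ia alpha_ib)
  ultimately show ?thesis using d4 by (simp add: sum_split card_singles)
qed

text \<open>Passing to the opposite class replaces every coordinate by its complement to
  \<open>p\<close>.\<close>

lemma level0_sum_lt:
  assumes "\<not> p dvd g"
  shows "(\<Sum>i\<in>UNIV. \<alpha> i * g mod p) < (int d - 1) * p"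
proof -
  have "p < (\<Sum>i\<in>UNIV. \<alpha> i * - g mod p)" using assms by (intro level0_sum_gt) simp
  also have "\<dots> = int d * p - (\<Sum>i\<in>UNIV. \<alpha> i * g mod p)"
    unfolding alpha_mod_compl[OF assms] by (simp add: sum_subtractf d_def)
  finally show ?thesis by (simp add: algebra_simps)
qed

section \<open>Sums, vertices and splittings in the semigroup\<close>

text \<open>The weights add up to zero modulo \<open>p\<close> and the \<open>T i\<close> to
  \<open>N\<close>, so neither the class nor the height affects the sum modulo \<open>N\<close>:
  degrees are integers.\<close>

lemma lattice_sum_dvd:
  assumes "\<And>i. N dvd \<sigma> i - D * \<alpha> i * g + u * T i"
  shows "N dvd sum \<sigma> UNIV"
proof -
  have "N dvd (\<Sum>i\<in>UNIV. \<sigma> i - D * \<alpha> i * g + u * T i)" using assms by (intro dvd_sum) auto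
  also have "\<dots> = sum \<sigma> UNIV - D * sum \<alpha> UNIV * g + u * N"
    by (simp add: sum.distrib sum_subtractf flip: sum_distrib_left sum_distrib_right sum_T)
  finally have "N dvd sum \<sigma> UNIV - D * sum \<alpha> UNIV * g" by (simp add: dvd_add_left_iff)
  moreover have "N dvd D * sum \<alpha> UNIV * g" using alpha_sum by (simp add: N_def mult_dvd_mono dvd_mult2)
  ultimately show ?thesis by (simp add: dvd_diff_left_iff)
qed

lemma S_intro:
  assumes "\<And>i. N dvd \<sigma> i - D * \<alpha> i * g + u * T i" "\<And>i. 0 \<le> \<sigma> i"
    "sum \<sigma> UNIV = N * int k" "0 \<le> u" "u \<le> N * int k"
  shows "S k \<sigma> u"
  using assms unfolding S_def by blast

lemma S_add:
  assumes "S j \<sigma> u" "S k \<sigma>' u'"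
  shows "S (j + k) (\<lambda>i. \<sigma> i + \<sigma>' i) (u + u')"
proof -
  obtain g g' where "\<And>i. N dvd \<sigma> i - D * \<alpha> i * g + u * T i" "\<And>i. N dvd \<sigma>' i - D * \<alpha> i * g' + u' * T i"
    using assms unfolding S_def by blast
  then have "N dvd (\<sigma> i - D * \<alpha> i * g + u * T i) + (\<sigma>' i - D * \<alpha> i * g' + u' * T i)" for i
    by (simp only: dvd_add)
  then have "\<forall>i. N dvd (\<sigma> i + \<sigma>' i) - D * \<alpha> i * (g + g') + (u + u') * T i"
    by (simp add: algebra_simps)
  then show ?thesis
    using assms by (intro S_intro[where g = "g + g'"]) (auto simp: S_def sum.distrib algebra_simps)
qed

definition vert :: "'n \<Rightarrow> 'n \<Rightarrow> int" where "vert i j = (if j = i then N else 0)"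

lemma S_vert: "w = 0 \<or> w = N \<Longrightarrow> S 1 (vert i) w"
  unfolding S_def vert_def using N_pos by (auto intro!: exI[of _ 0])

lemma subtract_vertex:
  assumes "S (Suc k) \<sigma> u" "1 \<le> k" "N \<le> \<sigma> i"
  obtains w where "S 1 (vert i) w" "S k (\<lambda>j. \<sigma> j - vert i j) (u - w)"
proof -
  \<comment> \<open>Of the two prism vertices over \<open>i\<close>, the lower one is removed if the
    height fits into degree \<open>k\<close>, otherwise the upper one.\<close>
  define w where "w = (if u \<le> N * int k then 0 else N)"
  have w: "w = 0 \<or> w = N" by (simp add: w_def)
  obtain g where g: "\<And>i. N dvd \<sigma> i - D * \<alpha> i * g + u * T i" using assms unfolding S_def by blast
  have "N * 1 \<le> N * int k" using assms N_pos by (intro mult_left_mono) auto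
  moreover have "0 \<le> u" "u \<le> N * int k + N" using assms by (auto simp: S_def algebra_simps)
  ultimately have u: "0 \<le> u - w" "u - w \<le> N * int k"
    by (auto simp: w_def)
  have "N dvd (\<sigma> j - D * \<alpha> j * g + u * T j) - (vert i j + w * T j)" for j
    using g w by (intro dvd_diff) (auto simp: vert_def)
  then have "\<forall>j. N dvd (\<sigma> j - vert i j) - D * \<alpha> j * g + (u - w) * T j" by (simp add: algebra_simps)
  moreover have "sum (vert i) UNIV = N" by (simp add: vert_def)
  ultimately have "S k (\<lambda>j. \<sigma> j - vert i j) (u - w)"
    using assms u by (intro S_intro[where g = g])
      (auto simp: S_def sum_subtractf vert_def algebra_simps)
  then show thesis using that S_vert[OF w] by blast
qed

lemma big_coordinate:
  assumes "S k \<sigma> u" "d \<le> k"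
  obtains i where "N \<le> \<sigma> i"
proof (rule ccontr)
  assume "\<not> thesis"
  then have "\<sigma> i < N" for i using that[of i] by linarith
  then have "sum \<sigma> UNIV < (\<Sum>i\<in>(UNIV::'n set). N)" by (intro sum_strict_mono) auto
  moreover have "N * int d \<le> N * int k" using assms N_pos by (intro mult_left_mono) auto
  ultimately show False using assms by (simp add: S_def d_def mult.commute)
qed

text \<open>The minimal representative \<open>y\<close> of a class at a height below
  \<open>N\<close> splits off as soon as it fits below \<open>x\<close>. Changing a height by
  multiples of \<open>N\<close> preserves the lattice condition, so it remains to balance the
  heights of the two summands; \<open>top\<close> makes this possible.\<close>

lemma split_at_class:
  fixes g u' :: int and k :: nat
  defines "y \<equiv> \<lambda>i. (D * \<alpha> i * g - u' * T i) mod N"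
  assumes S: "S k x u" and u': "0 \<le> u'" "u' < N" "u' \<le> u"
    and top: "u' = 0 \<or> u \<le> u' + N * (int k - 1)"
    and y_le: "\<And>i. y i \<le> x i" and y_pos: "0 < sum y UNIV" and y_lt: "sum y UNIV < sum x UNIV"
  obtains j where "1 \<le> j" "j < k" "sum y UNIV = N * int j" "decomp j (k - j) x u"
proof -
  have y0: "0 \<le> y i" for i using N_pos by (simp add: y_def)
  have y_lat: "N dvd y i - D * \<alpha> i * g + u' * T i" for i
  proof -
    have "N dvd (D * \<alpha> i * g - u' * T i) - y i" by (simp add: y_def)
    then have "N dvd - ((D * \<alpha> i * g - u' * T i) - y i)" by (simp only: dvd_minus_iff)
    then show ?thesis by (simp add: algebra_simps)
  qed
  then have "N dvd sum y UNIV" by (rule lattice_sum_dvd)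
  then obtain q where q: "sum y UNIV = N * q" by blast
  have "N * 0 < N * q" using y_pos q by simp
  then have q0: "0 < q" using N_pos by (metis mult_less_cancel_left_pos)
  have "N * q < N * int k" using y_lt q S by (simp add: S_def)
  then have qk: "q < int k" using N_pos by (metis mult_less_cancel_left_pos)
  \<comment> \<open>The least number of steps of size \<open>N\<close> that the first summand must
    take over for the second not to exceed height \<open>N * (int k - q)\<close>; the division
    yields the ceiling of \<open>(u - u') / N\<close>.\<close>
  define a where "a = max 0 (- ((u' - u) div N) - (int k - q))"
  have "(u - u') \<le> N * (- ((u' - u) div N))"
    using minus_mod_eq_mult_div[of "u' - u" N] pos_mod_sign[of N "u' - u"] N_pos
    unfolding mult_minus_right by linarith
  moreover have "N * (- ((u' - u) div N)) < u - u' + N"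
    using minus_mod_eq_mult_div[of "u' - u" N] pos_mod_bound[of N "u' - u"] N_pos
    unfolding mult_minus_right by linarith
  moreover define v where "v = - ((u' - u) div N)"
  ultimately have v: "u - u' \<le> N * v" "N * v < u - u' + N" by auto
  have a: "a = max 0 (v - (int k - q))" by (simp add: a_def v_def)
  have u: "0 \<le> u" "u \<le> N * int k" using S by (auto simp: S_def)
  have Na: "N * a = max 0 (N * v - (N * int k - N * q))"
    using N_pos unfolding a by (simp add: max_mult_distrib_left right_diff_distrib)
  have Nq: "N \<le> N * q" using mult_left_mono[of 1 q N] q0 N_pos by simp
  have Nkq: "N \<le> N * int k - N * q"
    using mult_left_mono[of 1 "int k - q" N] qk N_pos by (simp add: algebra_simps)
  have lev1: "0 \<le> u' + N * a" using Na u' by simp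
  have lev2: "u' + N * a \<le> N * q"
  proof (cases "u' = 0")
    case True
    have "N * v < N * (int k + 1)" using v(2) u True by (simp add: algebra_simps)
    then have "v < int k + 1" using N_pos by (metis mult_less_cancel_left_pos)
    then have "N * v \<le> N * int k" using N_pos by (intro mult_left_mono) auto
    then show ?thesis using Na True Nq u' N_pos by linarith
  next
    case False
    then have "N * v < N * int k" using v(2) top by (simp add: algebra_simps)
    then have "v < int k" using N_pos by (metis mult_less_cancel_left_pos)
    then have "N * v \<le> N * (int k - 1)" using N_pos by (intro mult_left_mono) auto
    then have "N * v \<le> N * int k - N" by (simp add: right_diff_distrib)
    then show ?thesis using Na Nq u' by linarith
  qed
  have lev3: "0 \<le> u - (u' + N * a)" using Na v Nkq u' by linarith
  have lev4: "u - (u' + N * a) \<le> N * int k - N * q" using Na v by linarith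
  define j where "j = nat q"
  have j: "int j = q" using q0 by (simp add: j_def)
  have jk: "1 \<le> j" "j < k" using q0 qk j by auto
  have Sy: "S j y (u' + N * a)"
  proof (rule S_intro[where g = g])
    show "N dvd y i - D * \<alpha> i * g + (u' + N * a) * T i" for i
    proof -
      have "N dvd (y i - D * \<alpha> i * g + u' * T i) + N * (a * T i)" using y_lat[of i] by simp
      then show ?thesis by (simp add: algebra_simps)
    qed
  qed (use y0 q j lev1 lev2 in auto)
  obtain h where h: "\<And>i. N dvd x i - D * \<alpha> i * h + u * T i" using S unfolding S_def by blast
  have "S (k - j) (\<lambda>i. x i - y i) (u - (u' + N * a))"
  proof (rule S_intro[where g = "h - g"])
    show "N dvd x i - y i - D * \<alpha> i * (h - g) + (u - (u' + N * a)) * T i" for i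
    proof -
      have "N dvd (x i - D * \<alpha> i * h + u * T i) - (y i - D * \<alpha> i * g + u' * T i) - N * (a * T i)"
        using h[of i] y_lat[of i] by (simp only: dvd_diff dvd_triv_left)
      then show ?thesis by (simp add: algebra_simps)
    qed
    show "(\<Sum>i\<in>UNIV. x i - y i) = N * int (k - j)"
      using S q j jk by (simp add: S_def sum_subtractf of_nat_diff algebra_simps)
    show "u - (u' + N * a) \<le> N * int (k - j)"
      using lev4 j jk by (simp add: of_nat_diff algebra_simps)
  qed (use y_le lev3 in auto)
  then have "decomp j (k - j) x u" using Sy unfolding decomp_def by blast
  then show thesis using that jk q j by simp
qed

text \<open>The classes \<open>g\<close> whose minimal representative at height \<open>u'\<close> exceeds \<open>N - \<Psi>\<close> in coordinate \<open>l\<close>.\<close>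

definition wraps :: "int \<Rightarrow> 'n \<Rightarrow> int \<Rightarrow> int set" where
  "wraps u' l \<Psi> = {g \<in> {0..<p}. 0 < (u' * T l - D * \<alpha> l * g) mod N \<and>
     (u' * T l - D * \<alpha> l * g) mod N < \<Psi>}"

section \<open>Counting the classes that do not fit\<close>

lemma not_wraps_le:
  assumes "g \<in> {0..<p}" "g \<notin> wraps u' l (N - b)" "0 \<le> b"
  shows "(D * \<alpha> l * g - u' * T l) mod N \<le> b"
proof -
  let ?w = "(u' * T l - D * \<alpha> l * g) mod N"
  have "0 \<le> ?w" using N_pos by simp
  then have "?w = 0 \<or> N - b \<le> ?w" using assms by (auto simp: wraps_def)
  moreover have "(D * \<alpha> l * g - u' * T l) mod N = (if ?w = 0 then 0 else N - ?w)"
    using zmod_zminus1_eq_if[of "u' * T l - D * \<alpha> l * g" N] by simp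
  ultimately show ?thesis using assms by auto
qed

text \<open>The tested value has the same residue modulo \<open>D\<close> for all classes, and since
  \<open>\<alpha> l\<close> is a unit modulo \<open>p\<close>, its quotient by \<open>D\<close>
  determines the class. So the classes inject into the quotients \<open>a\<close>, whatever the
  weights are.\<close>

lemma card_wraps_le:
  "card (wraps u' l \<Psi>) \<le> card {a \<in> {0..<p}. 0 < u' * T l mod D + D * a \<and> u' * T l mod D + D * a < \<Psi>}"
proof (rule card_inj_on_le)
  let ?w = "\<lambda>g. (u' * T l - D * \<alpha> l * g) mod N"
  have wD: "?w g = u' * T l mod D + D * (?w g div D)" for g
  proof -
    have "?w g mod D = (u' * T l - D * \<alpha> l * g) mod D" by (simp add: N_def mod_mod_cancel)
    also have "\<dots> = u' * T l mod D" by (simp add: mult.assoc mod_diff_right_eq [symmetric])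
    finally show ?thesis by (metis mod_mult_div_eq)
  qed
  show "inj_on (\<lambda>g. ?w g div D) (wraps u' l \<Psi>)"
  proof (rule inj_onI)
    fix g h assume g: "g \<in> wraps u' l \<Psi>" "h \<in> wraps u' l \<Psi>" and "?w g div D = ?w h div D"
    then have "?w g = ?w h" using wD by metis
    then have "N dvd (u' * T l - D * \<alpha> l * g) - (u' * T l - D * \<alpha> l * h)" by (simp add: mod_eq_dvd_iff)
    then have "D * p dvd D * (\<alpha> l * (h - g))" by (simp add: N_def algebra_simps)
    then have "p dvd h - g" using D_pos p_dvd_alpha by simp
    then show "g = h"
      using g by (auto simp: wraps_def) (metis mod_eq_dvd_iff mod_pos_pos_trivial)
  qed
  show "(\<lambda>g. ?w g div D) ` wraps u' l \<Psi> \<subseteq> {a \<in> {0..<p}. 0 < u' * T l mod D + D * a \<and> u' * T l mod D + D * a < \<Psi>}"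
  proof clarsimp
    fix g assume "g \<in> wraps u' l \<Psi>"
    moreover have "0 \<le> ?w g" "?w g < D * p" using N_pos by (auto simp: N_def)
    moreover from this have "0 \<le> ?w g div D" using D_pos by (simp add: pos_imp_zdiv_nonneg_iff)
    moreover have "D * (?w g div D) < D * p"
      using \<open>?w g < D * p\<close> wD[of g] pos_mod_sign[OF D_pos, of "u' * T l"] by linarith
    then have "?w g div D < p" using D_pos by (metis mult_less_cancel_left_pos)
    ultimately show "0 \<le> ?w g div D \<and> ?w g div D < p \<and> 0 < u' * T l mod D + D * (?w g div D) \<and>
        u' * T l mod D + D * (?w g div D) < \<Psi>"
      unfolding wD[symmetric] by (auto simp: wraps_def)
  qed
qed (rule finite_subset[of _ "{0..<p}"], auto)

text \<open>At height \<open>0\<close> the tested values are multiples of \<open>D\<close>, and the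
  value \<open>0\<close> does not count.\<close>

lemma card_wraps_level0:
  assumes "0 < \<Psi>"
  shows "int (card (wraps 0 l \<Psi>)) \<le> (\<Psi> - 1) div D"
proof -
  have "{a \<in> {0..<p}. 0 < 0 * T l mod D + D * a \<and> 0 * T l mod D + D * a < \<Psi>} \<subseteq> {1..(\<Psi> - 1) div D}"
  proof clarsimp
    fix a assume a: "0 < D * a" "D * a < \<Psi>"
    have "D * a div D \<le> (\<Psi> - 1) div D" using a D_pos by (intro zdiv_mono1) auto
    then show "1 \<le> a \<and> a \<le> (\<Psi> - 1) div D" using a D_pos by (simp add: zero_less_mult_iff)
  qed
  then have "card (wraps 0 l \<Psi>) \<le> card {1..(\<Psi> - 1) div D}"
    using card_wraps_le[of 0 l \<Psi>] by (meson card_mono finite_atLeastAtMost_int order.trans)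
  moreover have "0 \<le> (\<Psi> - 1) div D" using assms D_pos by (simp add: pos_imp_zdiv_nonneg_iff)
  ultimately show ?thesis by simp
qed

text \<open>The condition on the residues excludes the last, incomplete block of length
  \<open>D\<close>.\<close>

lemma card_wraps_high:
  assumes "0 < \<Psi>" "\<Psi> mod D \<le> u' * T l mod D"
  shows "int (card (wraps u' l \<Psi>)) \<le> \<Psi> div D"
proof -
  have "{a \<in> {0..<p}. 0 < u' * T l mod D + D * a \<and> u' * T l mod D + D * a < \<Psi>} \<subseteq> {0..<\<Psi> div D}"
  proof clarsimp
    fix a assume "u' * T l mod D + D * a < \<Psi>"
    then have "D * a < D * (\<Psi> div D)"
      using assms mod_mult_div_eq[of \<Psi> D] by linarith
    then show "a < \<Psi> div D" using D_pos by (metis mult_less_cancel_left_pos)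
  qed
  then have "card (wraps u' l \<Psi>) \<le> card {0..<\<Psi> div D}"
    using card_wraps_le[of u' l \<Psi>] by (meson card_mono finite_atLeastLessThan_int order.trans)
  moreover have "0 \<le> \<Psi> div D" using assms D_pos by (simp add: pos_imp_zdiv_nonneg_iff)
  ultimately show ?thesis by simp
qed

lemma unwrapped_class:
  assumes "finite G" "(\<Sum>l\<in>L. int (card (wraps u' l (\<Psi> l)))) < int (card G)"
  obtains g where "g \<in> G" "\<And>l. l \<in> L \<Longrightarrow> g \<notin> wraps u' l (\<Psi> l)"
proof (rule ccontr)
  assume "\<not> thesis"
  then have "G \<subseteq> (\<Union>l\<in>L. wraps u' l (\<Psi> l))" using that by blast
  moreover have "finite (wraps u' l (\<Psi> l))" for l
    by (rule finite_subset[of _ "{0..<p}"]) (auto simp: wraps_def)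
  ultimately have "card G \<le> card (\<Union>l\<in>L. wraps u' l (\<Psi> l))" by (intro card_mono) auto
  also have "\<dots> \<le> (\<Sum>l\<in>L. card (wraps u' l (\<Psi> l)))" by (intro card_UN_le) auto
  finally show False using assms(2) by (simp flip: of_nat_sum)
qed

lemma level0_class_sum:
  assumes "\<not> p dvd g"
  shows "N < (\<Sum>i\<in>UNIV. (D * \<alpha> i * g - 0 * T i) mod N)"
    "(\<Sum>i\<in>UNIV. (D * \<alpha> i * g - 0 * T i) mod N) < N * (int d - 1)"
proof -
  have "(D * \<alpha> i * g - 0 * T i) mod N = D * (\<alpha> i * g mod p)" for i
    using mult_mod_right[of D "\<alpha> i * g" p] by (simp add: N_def mult.assoc)
  then have *: "(\<Sum>i\<in>UNIV. (D * \<alpha> i * g - 0 * T i) mod N) = D * (\<Sum>i\<in>UNIV. \<alpha> i * g mod p)"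
    by (simp add: sum_distrib_left)
  show "N < (\<Sum>i\<in>UNIV. (D * \<alpha> i * g - 0 * T i) mod N)"
    unfolding * using mult_strict_left_mono[OF level0_sum_gt[OF assms] D_pos] by (simp add: N_def)
  show "(\<Sum>i\<in>UNIV. (D * \<alpha> i * g - 0 * T i) mod N) < N * (int d - 1)"
    unfolding * using mult_strict_left_mono[OF level0_sum_lt[OF assms] D_pos]
    by (simp add: N_def mult_ac)
qed

section \<open>Decompositions in degrees \<open>d - 1\<close> and \<open>d\<close>\<close>

lemma T_mod_D: "u * T l mod D = u * e l mod D"
proof -
  have "u * T l = u * e l + D * (u * c l)" by (simp add: T_def algebra_simps)
  then show ?thesis by simp
qed

text \<open>The class disappears modulo \<open>D\<close>, so the residue of a deficit depends on the
  height alone.\<close>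

lemma complement_mod_D:
  assumes "N dvd x - D * \<alpha> l * g + u * T l"
  shows "(N - x) mod D = u * e l mod D"
proof -
  have "D dvd x - D * \<alpha> l * g + u * T l" using assms by (metis N_def dvd_mult_left)
  then have "D dvd N - (D * \<alpha> l * g) - (x - D * \<alpha> l * g + u * T l)"
    by (intro dvd_diff) (auto simp: N_def mult.assoc)
  then have "D dvd (N - x) - u * T l" by (simp add: algebra_simps)
  then show ?thesis by (simp add: mod_eq_dvd_iff T_mod_D[symmetric])
qed

text \<open>An element at height \<open>1\<close> whose deficits \<open>N - x l\<close> sum to \<open>N\<close> has deficits \<open>T l\<close>, by the tiling.\<close>

lemma height_one_unique:
  assumes S: "S (d - 1) x 1" and small: "\<And>l. x l < N"
  shows "N - x l = T l"
proof -
  obtain g where g: "\<And>l. N dvd x l - D * \<alpha> l * g + 1 * T l" using S unfolding S_def by blast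
  have x0: "0 \<le> x l" for l using S by (simp add: S_def)
  have sumN: "(\<Sum>l\<in>UNIV. N - x l) = N"
    using S d4 by (simp add: S_def sum_subtractf of_nat_diff d_def algebra_simps)
  define \<rho> where "\<rho> = (\<lambda>l. - (\<alpha> l * g) mod p)"
  have cong: "N dvd (N - x l) - (T l + D * \<rho> l)" for l
  proof -
    have "p dvd - (\<alpha> l * g) - \<rho> l" by (simp add: \<rho>_def)
    then have "N dvd D * (- (\<alpha> l * g) - \<rho> l)" unfolding N_def by (rule mult_dvd_mono[OF dvd_refl])
    then have "N dvd N - (x l - D * \<alpha> l * g + 1 * T l) + D * (- (\<alpha> l * g) - \<rho> l)"
      using g[of l] by (simp only: dvd_add dvd_diff dvd_refl)
    then show ?thesis by (simp add: algebra_simps)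
  qed
  show ?thesis
  proof (cases "p dvd g")
    case True
    then have "\<rho> l = 0" by (simp add: \<rho>_def)
    then have "N dvd (N - x l) - T l" using cong[of l] by simp
    moreover have "\<bar>(N - x l) - T l\<bar> < N"
      using small[of l] x0[of l] T_bounds[of l] D_pos by linarith
    ultimately show ?thesis using zdvd_not_zless[of "\<bar>(N - x l) - T l\<bar>" N] by force
  next
    case False
    \<comment> \<open>The coordinates in which \<open>T l + D * \<rho> l\<close> exceeds
      \<open>N\<close> and must be reduced; their tiles contain \<open>g\<close>, so there is at
      most one.\<close>
    define W where "W = {l. \<alpha> l * g mod p \<le> c l}"
    have \<rho>: "\<rho> l = p - \<alpha> l * g mod p" for l
      using alpha_mod_compl[OF False, of l] by (simp add: \<rho>_def)
    have def: "N - x l = T l + D * \<rho> l - (if l \<in> W then N else 0)" for l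
    proof -
      have \<rho>_b: "0 \<le> \<rho> l" "\<rho> l < p" using p_pos by (auto simp: \<rho>_def)
      obtain q where q: "(N - x l) - (T l + D * \<rho> l) = N * q" using cong[of l] by blast
      have b: "0 < N - x l" "N - x l \<le> N" using small[of l] x0[of l] by auto
      show ?thesis
      proof (cases "l \<in> W")
        case True
        then have "p \<le> c l + \<rho> l" by (simp add: W_def \<rho>)
        then have "D * p \<le> D * (c l + \<rho> l)" using D_pos by (intro mult_left_mono) auto
        then have "N < T l + D * \<rho> l" using e_bounds[of l] by (simp add: T_def N_def algebra_simps)
        moreover have "D * \<rho> l \<le> D * p" using \<rho>_b D_pos by (intro mult_left_mono) auto
        then have "T l + D * \<rho> l < 2 * N" using T_bounds[of l] by (simp add: N_def)
        ultimately have "N * (-2) < N * q" "N * q < N * 0" using q b by linarith+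
        then have "-2 < q" "q < 0" using N_pos by (metis mult_less_cancel_left_pos)+
        then have "q = -1" by simp
        then show ?thesis using q True by simp
      next
        case nW: False
        then have "c l + \<rho> l \<le> p - 1" by (simp add: W_def \<rho>)
        then have "D * (c l + \<rho> l) \<le> D * (p - 1)" using D_pos by (intro mult_left_mono) auto
        then have "T l + D * \<rho> l < N" using e_bounds[of l] by (simp add: T_def N_def algebra_simps)
        moreover have "0 \<le> D * \<rho> l" using \<rho>_b D_pos by simp
        then have "0 < T l + D * \<rho> l" using T_bounds[of l] D_pos by linarith
        ultimately have "N * (-1) < N * q" "N * q < N * 1" using q b by linarith+
        then have "-1 < q" "q < 1" using N_pos by (metis mult_less_cancel_left_pos)+
        then have "q = 0" by simp
        then show ?thesis using q nW by simp
      qed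
    qed
    have "card W \<le> 1"
      using tile_unique[OF False] unfolding W_def One_nat_def
      by (intro card_le_Suc0_iff_eq[THEN iffD2]) auto
    \<comment> \<open>With at most one reduction by \<open>N\<close>, the sum of
      \<open>\<rho>\<close> is at most \<open>p\<close>, which contradicts
      \<open>level0_sum_gt\<close> for the class \<open>- g\<close>.\<close>
    have "N = (\<Sum>l\<in>UNIV. T l + D * \<rho> l - (if l \<in> W then N else 0))" using sumN def by simp
    also have "\<dots> = N + D * sum \<rho> UNIV - N * int (card W)"
      by (simp add: sum.distrib sum_subtractf sum_T sum.If_cases mult.commute[of N] flip: sum_distrib_left)
    finally have "D * sum \<rho> UNIV = D * (p * int (card W))" unfolding N_def mult.assoc by linarith
    then have "sum \<rho> UNIV = p * int (card W)" using D_pos by simp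
    also have "\<dots> \<le> p" using \<open>card W \<le> 1\<close> p_pos mult_left_mono[of "int (card W)" 1 p] by simp
    finally have "sum \<rho> UNIV \<le> p" .
    moreover have "p < sum \<rho> UNIV"
      using level0_sum_gt[of "- g"] False by (simp add: \<rho>_def)
    ultimately show ?thesis by simp
  qed
qed

text \<open>The deficits sum to \<open>N\<close>, so tight quotients leave exactly \<open>D\<close>
  for the sum of the remainders \<open>f l\<close>, all positive. At indices other than
  \<open>ia\<close> and \<open>ib\<close> the remainder is \<open>t * (u mod int d)\<close>, and
  \<open>d - 2\<close> of these stay below \<open>D = int d * t\<close> only if
  \<open>u mod int d = 1\<close>.\<close>

lemma deficits_residues:
  assumes S: "S (d - 1) x u" and small: "\<And>l. x l < N"
    and tight: "p - 1 \<le> (\<Sum>l\<in>UNIV. (N - x l - 1) div D)"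
  shows "u mod int d = 1" "(\<Sum>l\<in>UNIV. (N - x l - 1) div D) = p - 1"
    "(N - x l) div D = (N - x l - 1) div D" "(N - x l) mod D \<le> 2 * t"
    "l \<noteq> ia \<Longrightarrow> l \<noteq> ib \<Longrightarrow> (N - x l) mod D = t"
proof -
  obtain g where g: "\<And>l. N dvd x l - D * \<alpha> l * g + u * T l" using S unfolding S_def by blast
  define a where "a = (\<lambda>l. (N - x l - 1) div D)"
  \<comment> \<open>The shift by one puts the remainders into the range from \<open>1\<close> to
    \<open>D\<close>; this keeps them positive.\<close>
  define f where "f = (\<lambda>l. (N - x l - 1) mod D + 1)"
  have af: "N - x l = D * a l + f l" for l
    using mod_mult_div_eq[of "N - x l - 1" D] by (simp add: a_def f_def)
  have f1: "1 \<le> f l" for l using D_pos by (simp add: f_def)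
  have "(\<Sum>l\<in>UNIV. N - x l) = N"
    using S d4 by (simp add: S_def sum_subtractf of_nat_diff d_def algebra_simps)
  then have "N = D * sum a UNIV + sum f UNIV" by (simp add: af sum.distrib sum_distrib_left)
  then have sf: "sum f UNIV = D * (p - sum a UNIV)" by (simp add: N_def algebra_simps)
  have "(\<Sum>l\<in>(UNIV::'n set). 1) \<le> sum f UNIV" using f1 by (intro sum_mono) auto
  then have "D * 0 < D * (p - sum a UNIV)" using sf d4 by (simp add: d_def)
  then have "0 < p - sum a UNIV" using D_pos by (metis mult_less_cancel_left_pos)
  then have sa: "sum a UNIV = p - 1" using tight by (simp add: a_def)
  then show "(\<Sum>l\<in>UNIV. (N - x l - 1) div D) = p - 1" by (simp add: a_def)
  have sfD: "sum f UNIV = D" using sf sa by simp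
  have fs: "f ia + f ib + sum f (UNIV - {ia, ib}) = D" using sfD by (simp add: sum_split)
  have f_lt: "f l < D" for l
  proof -
    obtain l' where "l' \<noteq> l" using ia_ib by metis
    then have "f l + f l' = sum f {l, l'}" by simp
    also have "\<dots> \<le> sum f UNIV" using f1 by (intro sum_mono2) (auto intro: order.trans[OF zero_le_one f1])
    finally show ?thesis using sfD f1[of l'] by linarith
  qed
  have f_mod: "(N - x l) mod D = f l" and a_div: "(N - x l) div D = a l" for l
    using f_lt[of l] f1[of l] unfolding af by (simp_all add: div_pos_pos_trivial)
  show "(N - x l) div D = (N - x l - 1) div D" using a_div by (simp add: a_def)
  define v where "v = u mod int d"
  have f_single: "f l = t * v" if "l \<noteq> ia" "l \<noteq> ib" for l
  proof -
    have "f l = u * e l mod D" using complement_mod_D[OF g[of l]] f_mod by simp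
    also have "\<dots> = t * v"
      using mult_mod_right[of t u "int d"] that by (simp add: e_def D_def v_def mult.commute)
    finally show ?thesis .
  qed
  then have "sum f (UNIV - {ia, ib}) = (\<Sum>l\<in>UNIV - {ia, ib}. t * v)" by (intro sum.cong) auto
  then have ss: "sum f (UNIV - {ia, ib}) = (int d - 2) * (t * v)"
    by (simp add: card_singles int_d2)
  obtain l0 where "l0 \<noteq> ia" "l0 \<noteq> ib" by (rule single_exists)
  then have "0 < t * v" using f_single[of l0] f1[of l0] by simp
  then have v0: "0 < v" using t1 by (simp add: zero_less_mult_iff)
  have v1: "v = 1"
  proof (rule ccontr)
    assume "v \<noteq> 1"
    then have "t * 2 \<le> t * v" using v0 t1 by (intro mult_left_mono) auto
    then have "(int d - 2) * (t * 2) \<le> (int d - 2) * (t * v)" using d4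
      by (intro mult_left_mono[of "t * 2"]) auto
    moreover have "4 * t \<le> int d * t" using d4 t1 by (intro mult_right_mono) auto
    ultimately show False using fs ss f1[of ia] f1[of ib] by (simp add: D_def algebra_simps)
  qed
  then show "u mod int d = 1" by (simp add: v_def)
  show single: "(N - x l) mod D = t" if "l \<noteq> ia" "l \<noteq> ib"
    using f_single[OF that] f_mod[of l] v1 by simp
  have two: "f ia + f ib = 2 * t" using fs ss v1 by (simp add: D_def algebra_simps)
  show "(N - x l) mod D \<le> 2 * t"
    using two f1[of ia] f1[of ib] single t1 f_mod[of l] by (cases "l = ia"; cases "l = ib") auto
qed

text \<open>If the quotients are not tight, some nonzero class at height \<open>0\<close> is left
  over. Otherwise \<open>u\<close> is \<open>1\<close> modulo \<open>d\<close> but not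
  \<open>1\<close>, and a height that is \<open>3\<close> modulo \<open>d\<close> works: the
  residues there are at least those of the deficits, so at most \<open>p - 1\<close> of all
  \<open>p\<close> classes are excluded.\<close>

lemma degree_pred_decomposes:
  assumes S: "S (d - 1) x u" and small: "\<And>l. x l < N"
    and not_one: "u \<noteq> 1 \<or> (\<Sum>l\<in>UNIV. (N - x l - 1) div D) < p - 1"
  obtains j where "1 \<le> j" "j < d - 1" "decomp j (d - 1 - j) x u"
proof -
  have x0: "0 \<le> x l" for l using S by (simp add: S_def)
  have sumx: "sum x UNIV = N * (int d - 1)" using S d4 by (simp add: S_def of_nat_diff)
  show thesis
  proof (cases "(\<Sum>l\<in>UNIV. (N - x l - 1) div D) < p - 1")
    case True
    have "(\<Sum>l\<in>UNIV. int (card (wraps 0 l (N - x l)))) \<le> (\<Sum>l\<in>UNIV. (N - x l - 1) div D)"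
      using small by (intro sum_mono card_wraps_level0) simp
    then have "(\<Sum>l\<in>UNIV. int (card (wraps 0 l (N - x l)))) < int (card {1..<p})"
      using True p_pos by simp
    then obtain g where g: "g \<in> {1..<p}" "\<And>l. g \<notin> wraps 0 l (N - x l)"
      using unwrapped_class[of "{1..<p}" 0 "\<lambda>l. N - x l" UNIV] by auto
    have ndvd: "\<not> p dvd g" using g(1) zdvd_not_zless by auto
    have le: "(D * \<alpha> i * g - 0 * T i) mod N \<le> x i" for i
      using g x0 by (intro not_wraps_le) auto
    have u0: "0 \<le> u" using S by (simp add: S_def)
    note sums = level0_class_sum[OF ndvd]
    show thesis
      by (rule split_at_class[OF S order.refl N_pos u0 disjI1[OF refl] le
            order.strict_trans[OF N_pos sums(1)] sums(2)[folded sumx]]) (rule that)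
  next
    case False
    then have u1: "u \<noteq> 1" and tight: "p - 1 \<le> (\<Sum>l\<in>UNIV. (N - x l - 1) div D)"
      using not_one by auto
    note res = deficits_residues[OF S small tight]
    have u_b: "0 \<le> u" "u \<le> N * (int d - 1)" using S d4 by (auto simp: S_def of_nat_diff)
    obtain q where q: "u = int d * q + 1" using res(1) by (metis mult_div_mod_eq)
    have "q \<noteq> 0" using q u1 by auto
    moreover have "0 \<le> q"
    proof (rule ccontr)
      assume "\<not> 0 \<le> q"
      then have "int d * q \<le> int d * (- 1)" by (intro mult_left_mono) auto
      then show False using q u_b d4 by simp
    qed
    ultimately have "int d * 1 \<le> int d * q" by (intro mult_left_mono) auto
    then have u5: "int d + 1 \<le> u" using q by simp
    have Nd: "N = int d * (t * p)" by (simp add: N_def D_def)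
    \<comment> \<open>Both values are \<open>3\<close> modulo \<open>d\<close>, since
      \<open>d\<close> divides \<open>N\<close>. The second serves elements near the top, whose
      height is at most \<open>N * (int d - 1) - int d + 1\<close> because it is \<open>1\<close>
      modulo \<open>d\<close>.\<close>
    define u' where "u' = (if u \<le> 3 + N * (int d - 2) then 3 else N - int d + 3)"
    have dN: "int d * 1 \<le> int d * (t * p)"
      using t1 p_pos by (intro mult_left_mono) (auto simp: int_one_le_iff_zero_less)
    have u'_b: "0 \<le> u'" "u' < N" "u' \<le> u"
    proof -
      have "N * 2 \<le> N * (int d - 2)" using N_pos d4 by (intro mult_left_mono) auto
      moreover have "3 < N"
        using dN Nd d4 by linarith
      moreover have "int d \<le> N" using dN Nd by simp
      ultimately have "0 \<le> u' \<and> u' < N \<and> u' \<le> u"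
        using u5 d4 N_pos unfolding u'_def
        by (cases "u \<le> 3 + N * (int d - 2)"; simp only: if_True if_False; linarith)
      then show "0 \<le> u'" "u' < N" "u' \<le> u" by auto
    qed
    have top: "u \<le> u' + N * (int (d - 1) - 1)"
    proof (cases "u \<le> 3 + N * (int d - 2)")
      case True then show ?thesis using d4 by (simp add: u'_def of_nat_diff)
    next
      case False
      have "int d * q < int d * (t * p * (int d - 1))" using u_b q Nd by (simp add: mult.assoc)
      then have "q < t * p * (int d - 1)" using d4 by (simp add: mult_less_cancel_left)
      then have "int d * q \<le> int d * (t * p * (int d - 1) - 1)" by (intro mult_left_mono) auto
      then have "u \<le> N * (int d - 1) - int d + 1" using q Nd by (simp add: algebra_simps)
      then show ?thesis using False d4 by (simp add: u'_def of_nat_diff algebra_simps)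
    qed
    have u'_mod: "2 * t \<le> u' * e l mod D" for l
    proof -
      have "int d * r = 3 * r + (int d - 3) * r" by (simp add: algebra_simps)
      moreover have r_pos: "0 \<le> (int d - 3) * r" using d4 r0 by simp
      ultimately have r_b: "3 * r < t" "(int d - 3) * r < t" using r_t' r0 by linarith+
      define \<delta> where "\<delta> = e l - t"
      have \<delta>: "\<delta> = 0 \<or> \<delta> = r \<or> \<delta> = - r" by (auto simp: \<delta>_def e_def)
      \<comment> \<open>The residue of \<open>u' * e l\<close> modulo \<open>D\<close>:
        \<open>3 * t\<close> up to a multiple of \<open>\<delta>\<close> that is smaller than
        \<open>t\<close>.\<close>
      define w where "w = (if u \<le> 3 + N * (int d - 2) then 3 * t + 3 * \<delta> else 3 * t - (int d - 3) * \<delta>)"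
      have "D dvd u' * e l - w"
      proof (cases "u \<le> 3 + N * (int d - 2)")
        case True
        then show ?thesis by (simp add: u'_def w_def \<delta>_def)
      next
        case False
        then have "u' * e l - w = D * (p * e l - 1)"
          by (simp add: u'_def w_def \<delta>_def N_def D_def algebra_simps)
        then show ?thesis by simp
      qed
      moreover have w: "2 * t \<le> w" "w < D"
        using \<delta> r_b r_pos r0 t1 D_ge by (auto simp: w_def)
      then have "0 \<le> w" using t1 by simp
      ultimately show ?thesis using w by (metis mod_eq_dvd_iff mod_pos_pos_trivial)
    qed
    have "(\<Sum>l\<in>UNIV. int (card (wraps u' l (N - x l)))) \<le> (\<Sum>l\<in>UNIV. (N - x l) div D)"
    proof (intro sum_mono card_wraps_high)
      show "0 < N - x l" for l using small[of l] by simp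
      show "(N - x l) mod D \<le> u' * T l mod D" for l
        using res(4)[of l] u'_mod[of l] by (simp add: T_mod_D)
    qed
    also have "\<dots> = p - 1" using res(2,3) by simp
    finally have "(\<Sum>l\<in>UNIV. int (card (wraps u' l (N - x l)))) < int (card {0..<p})"
      using p_pos by simp
    then obtain g where g: "g \<in> {0..<p}" "\<And>l. g \<notin> wraps u' l (N - x l)"
      using unwrapped_class[of "{0..<p}" u' "\<lambda>l. N - x l" UNIV] by auto
    let ?y = "\<lambda>i. (D * \<alpha> i * g - u' * T i) mod N"
    have y_le: "?y i \<le> x i" for i using g x0 by (intro not_wraps_le) auto
    have y_mod: "(- ?y i) mod D = u' * T i mod D" for i
    proof -
      have "N dvd (D * \<alpha> i * g - u' * T i) - ?y i" by simp
      then have "D dvd (D * \<alpha> i * g - u' * T i) - ?y i" by (metis N_def dvd_mult_left)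
      then have "D dvd ((D * \<alpha> i * g - u' * T i) - ?y i) - D * \<alpha> i * g"
        by (simp only: dvd_diff dvd_triv_left mult.assoc)
      moreover have "((a - b) - y) - a = - y - b" for a b y :: int by simp
      ultimately have "D dvd - ?y i - u' * T i" by metis
      then show ?thesis by (simp add: mod_eq_dvd_iff)
    qed
    have y_pos: "0 < ?y i" for i
    proof -
      have "?y i \<noteq> 0" using y_mod[of i] u'_mod[of i] t1 by (auto simp: T_mod_D)
      moreover have "0 \<le> ?y i" using N_pos by simp
      ultimately show ?thesis by linarith
    qed
    obtain l0 where l0: "l0 \<noteq> ia" "l0 \<noteq> ib" by (rule single_exists)
    \<comment> \<open>The residues differ: the deficit of \<open>x\<close> gives \<open>t\<close>,
      that of \<open>?y\<close> at least \<open>2 * t\<close>. Hence the splitting is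
      proper.\<close>
    have "?y l0 \<noteq> x l0"
    proof
      assume "?y l0 = x l0"
      then have "(N - x l0) mod D = (D * p + - ?y l0) mod D" by (simp add: N_def)
      also have "\<dots> = (- ?y l0) mod D" by (rule mod_mult_self4)
      also have "\<dots> = u' * T l0 mod D" by (rule y_mod)
      finally show False using res(5)[OF l0] u'_mod[of l0] t1 by (simp add: T_mod_D)
    qed
    then have "?y l0 < x l0" using y_le[of l0] by simp
    then have lt: "sum ?y UNIV < sum x UNIV" using y_le by (intro sum_strict_mono_ex1) auto
    have pos: "0 < sum ?y UNIV" using y_pos by (intro sum_pos) auto
    show thesis
      by (rule split_at_class[OF S u'_b disjI2[OF top] y_le pos lt]) (rule that)
  qed
qed

text \<open>A degree \<open>d\<close> element is a vertex plus some \<open>x\<close> of degree \<open>d - 1\<close>. Either \<open>x\<close> decomposes, or it lies at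
  height \<open>1\<close> with deficits \<open>T\<close>; then some class at height \<open>0\<close> fits below \<open>x\<close> except in the coordinate
  of the vertex.\<close>

lemma degree_d_decomposes:
  assumes S: "S d z u"
  obtains j where "2 \<le> j" "j \<le> d - 2" "decomp j (d - j) z u"
proof -
  note that_thesis = that
  obtain i where i: "N \<le> z i" using big_coordinate[OF S] by auto
  have "S (Suc (d - 1)) z u" using S d4 by simp
  then obtain w where w: "S 1 (vert i) w" and Sx: "S (d - 1) (\<lambda>j. z j - vert i j) (u - w)"
    using i d4 by (rule_tac subtract_vertex[of "d - 1" z u i]) auto
  define x where "x = (\<lambda>j. z j - vert i j)"
  have Sx: "S (d - 1) x (u - w)" using Sx by (simp add: x_def)
  \<comment> \<open>The vertex goes back into the first summand, or into the second one if the first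
    already has degree \<open>d - 2\<close>; then both degrees lie between \<open>2\<close> and
    \<open>d - 2\<close>.\<close>
  have reduce: thesis if "1 \<le> j" "j < d - 1" "decomp j (d - 1 - j) x (u - w)" for j
  proof -
    obtain y v where y: "S j y v" "S (d - 1 - j) (\<lambda>i. x i - y i) (u - w - v)"
      using \<open>decomp j _ _ _\<close> by (auto simp: decomp_def)
    show thesis
    proof (cases "j + 1 \<le> d - 2")
      case True
      have "S (j + 1) (\<lambda>i'. y i' + vert i i') (v + w)" using S_add[OF y(1) w] .
      moreover have "S (d - (j + 1)) (\<lambda>i'. z i' - (y i' + vert i i')) (u - (v + w))"
        using y(2) by (simp add: x_def algebra_simps)
      ultimately have "decomp (j + 1) (d - (j + 1)) z u" unfolding decomp_def by blast
      then show ?thesis using that(1) True by (intro that_thesis[of "j + 1"]) auto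
    next
      case False
      then have j: "j = d - 2" using that by simp
      have "S (d - 1 - j + 1) (\<lambda>i'. (x i' - y i') + vert i i') ((u - w - v) + w)"
        using S_add[OF y(2) w] .
      moreover have "d - 1 - j + 1 = d - j" using j d4 by simp
      ultimately have "S (d - j) (\<lambda>i'. z i' - y i') (u - v)" by (simp add: x_def)
      then have "decomp j (d - j) z u" unfolding decomp_def using y(1) by blast
      then show ?thesis using j d4 by (intro that_thesis[of j]) auto
    qed
  qed
  show thesis
  proof (cases "\<exists>l. N \<le> x l")
    case True
    then obtain l where l: "N \<le> x l" by blast
    have "Suc (d - 2) = d - 1" using d4 by simp
    then have "S (Suc (d - 2)) x (u - w)" using Sx by simp
    then obtain w' where "S 1 (vert l) w'" "S (d - 2) (\<lambda>j. x j - vert l j) (u - w - w')"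
      using l d4 by (rule_tac subtract_vertex[of "d - 2" x "u - w" l]) auto
    then have "decomp 1 (d - 1 - 1) x (u - w)" unfolding decomp_def by (auto simp: numeral_2_eq_2)
    then show ?thesis using d4 by (intro reduce[of 1]) auto
  next
    case False
    then have small: "x l < N" for l by (meson not_le)
    show ?thesis
    proof (cases "u - w \<noteq> 1 \<or> (\<Sum>l\<in>UNIV. (N - x l - 1) div D) < p - 1")
      case True
      then show ?thesis using degree_pred_decomposes[OF Sx small] reduce by blast
    next
      case False
      then have u1: "u - w = 1" and tight: "p - 1 \<le> (\<Sum>l\<in>UNIV. (N - x l - 1) div D)" by auto
      have a_sum: "(\<Sum>l\<in>UNIV. (N - x l - 1) div D) = p - 1"
        using deficits_residues(2)[OF Sx small tight] .
      have "D \<le> N - x i - 1"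
        using height_one_unique[where x = x and l = i, OF _ small] Sx u1 T_bounds(1)[of i] by simp
      \<comment> \<open>Coordinate \<open>i\<close> accounts for at least one unit of the sum of
        quotients. Leaving it out lowers the count below \<open>p - 1\<close>, so a nonzero class
        becomes available.\<close>
      then have a_i: "1 \<le> (N - x i - 1) div D"
        using zdiv_mono1[of D "N - x i - 1" D] D_pos by simp
      have "(\<Sum>l\<in>UNIV - {i}. int (card (wraps 0 l (N - x l)))) \<le> (\<Sum>l\<in>UNIV - {i}. (N - x l - 1) div D)"
        using small by (intro sum_mono card_wraps_level0) simp
      also have "\<dots> = (p - 1) - (N - x i - 1) div D" using a_sum by (simp add: sum_diff1)
      finally have "(\<Sum>l\<in>UNIV - {i}. int (card (wraps 0 l (N - x l)))) < int (card {1..<p})"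
        using a_i p_pos by simp
      then obtain g where g: "g \<in> {1..<p}" "\<And>l. l \<noteq> i \<Longrightarrow> g \<notin> wraps 0 l (N - x l)"
        using unwrapped_class[of "{1..<p}" 0 "\<lambda>l. N - x l" "UNIV - {i}"] by auto
      have ndvd: "\<not> p dvd g" using g(1) zdvd_not_zless by auto
      have le: "(D * \<alpha> l * g - 0 * T l) mod N \<le> z l" for l
      proof (cases "l = i")
        case True
        have "(D * \<alpha> l * g - 0 * T l) mod N < N" using N_pos by simp
        then show ?thesis using i unfolding True by linarith
      next
        case False
        then have "x l = z l" by (simp add: x_def vert_def)
        moreover have "0 \<le> x l" using Sx by (simp add: S_def)
        ultimately show ?thesis using not_wraps_le[of g 0 l "x l"] g(1) g(2)[OF False] by auto
      qed
      note sums = level0_class_sum[OF ndvd]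
      have u0: "0 \<le> u" using S by (simp add: S_def)
      have "(\<Sum>i\<in>UNIV. (D * \<alpha> i * g - 0 * T i) mod N) < sum z UNIV"
        using sums(2) S N_pos by (simp add: S_def right_diff_distrib)
      then obtain j where j: "(\<Sum>i\<in>UNIV. (D * \<alpha> i * g - 0 * T i) mod N) = N * int j"
          "decomp j (d - j) z u"
        by (rule split_at_class[OF S order.refl N_pos u0 disjI1[OF refl] le
            order.strict_trans[OF N_pos sums(1)]])
      have "N * 1 < N * int j" "N * int j < N * (int d - 1)" using sums j(1) by simp_all
      then have "1 < int j" "int j < int d - 1" using N_pos by (metis mult_less_cancel_left_pos)+
      then show ?thesis using j(2) by (intro that_thesis[of j]) auto
    qed
  qed
qed

section \<open>The irreducible point of degree \<open>d - 1\<close>\<close>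

lemma S_irreducible_point: "S (d - 1) (\<lambda>i. N - T i) 1"
proof (rule S_intro[where g = 0])
  show "0 \<le> N - T i" for i using T_bounds(2)[of i] by simp
  show "(\<Sum>i\<in>UNIV. N - T i) = N * int (d - 1)"
    using d4 by (simp add: sum_subtractf sum_T of_nat_diff d_def algebra_simps)
  have "N * 1 \<le> N * int (d - 1)" using N_pos d4 by (intro mult_left_mono) auto
  then show "1 \<le> N * int (d - 1)" using N_pos by linarith
qed auto

text \<open>In a decomposition one summand has height \<open>0\<close>; by the tiling its class exceeds \<open>N - T i\<close> for some \<open>i\<close>.\<close>

lemma irreducible_point:
  assumes "S j \<sigma> u" "S k \<sigma>' u'" "1 \<le> j" "1 \<le> k" "u + u' = 1" "\<And>i. \<sigma> i + \<sigma>' i = N - T i"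
  shows False
proof -
  have height0: False if S: "S j \<sigma> 0" and j: "1 \<le> j" and le: "\<And>i. \<sigma> i \<le> N - T i" for j \<sigma>
  proof -
    obtain g where g: "\<And>i. N dvd \<sigma> i - D * \<alpha> i * g + 0 * T i" using S unfolding S_def by blast
    have \<sigma>_ge: "D * (\<alpha> i * g mod p) \<le> \<sigma> i" for i
    proof -
      have "\<sigma> i mod N = D * \<alpha> i * g mod N" using g[of i] by (simp add: mod_eq_dvd_iff)
      also have "\<dots> = D * (\<alpha> i * g mod p)"
        using mult_mod_right[of D "\<alpha> i * g" p] by (simp add: N_def mult.assoc)
      finally show ?thesis using S N_pos by (metis S_def zmod_le_nonneg_dividend)
    qed
    show False
    proof (cases "p dvd g")
      case True
      have "\<sigma> i = 0" for i
      proof -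
        have "N dvd D * \<alpha> i * g" using True by (simp add: N_def mult_dvd_mono)
        then have "N dvd (\<sigma> i - D * \<alpha> i * g + 0 * T i) + D * \<alpha> i * g" using g[of i] by (simp only: dvd_add)
        then have "N dvd \<sigma> i" by simp
        moreover have "0 \<le> \<sigma> i" "\<sigma> i < N" using S le[of i] T_bounds(1)[of i] D_pos by (auto simp: S_def)
        ultimately show ?thesis using zdvd_not_zless by force
      qed
      then have "N * int j = 0" using S by (simp add: S_def)
      then show False using N_pos j by simp
    next
      case False
      then have "\<not> p dvd - g" by simp
      then obtain i where "\<alpha> i * - g mod p \<le> c i" by (rule tile_exists)
      then have "p - c i \<le> \<alpha> i * g mod p" using alpha_mod_compl[OF False, of i] by simp
      then have "D * (p - c i) \<le> D * (\<alpha> i * g mod p)" using D_pos by (intro mult_left_mono) auto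
      then have "D * p - D * c i \<le> N - T i"
        using \<sigma>_ge[of i] le[of i] by (simp add: right_diff_distrib)
      then show False using e_bounds(1)[of i] by (simp add: N_def T_def)
    qed
  qed
  have "u = 0 \<or> u' = 0" using assms by (auto simp: S_def)
  then show False
  proof
    assume "u = 0"
    moreover have "\<sigma> i \<le> N - T i" for i
    proof -
      have "0 \<le> \<sigma>' i" using assms(2) by (simp add: S_def)
      then show ?thesis using assms(6)[of i] by linarith
    qed
    ultimately show False using height0[of j \<sigma>] assms by blast
  next
    assume "u' = 0"
    moreover have "\<sigma>' i \<le> N - T i" for i
    proof -
      have "0 \<le> \<sigma> i" using assms(1) by (simp add: S_def)
      then show ?thesis using assms(6)[of i] by linarith
    qed
    ultimately show False using height0[of k \<sigma>'] assms by blast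
  qed
qed

section \<open>The facet that obstructs IDP of the small multiples\<close>

context
  assumes p_T: "p dvd T ib" and T_cop: "coprime (T ib) D" and p_big: "(int d - 2) * (int d + 1) * t < p"
begin

text \<open>\<open>corner\<close> is the lowest lattice point above the base in the facet \<open>\<sigma> ib = 0\<close>. Its height being minimal, it
  cannot be split even after adding multiples of the vertex \<open>ia\<close>.\<close>

definition corner :: "'n \<Rightarrow> int" where
  "corner i = (if i = ib then 0 else if i = ia then D * ((int d - 2) * (int d + 1) * t)
     else N - D * ((int d + 1) * t))"

lemma single_T: "i \<noteq> ia \<Longrightarrow> i \<noteq> ib \<Longrightarrow> T i = (int d + 1) * t"
  by (simp add: T_def c_def e_def D_def algebra_simps)

lemma corner_bounds: "0 \<le> corner i" "corner i < N"
proof -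
  have "0 < (int d + 1) * t" using t1 by simp
  have "1 * ((int d + 1) * t) \<le> (int d - 2) * ((int d + 1) * t)"
    using d4 t1 by (intro mult_right_mono) auto
  then have "(int d + 1) * t < p" using p_big unfolding mult.assoc by linarith
  then have "D * ((int d + 1) * t) < N" "D * ((int d - 2) * (int d + 1) * t) < N"
    unfolding N_def using D_pos p_big by (auto intro!: mult_strict_left_mono)
  moreover have "0 < D * ((int d + 1) * t)" using D_pos t1 by simp
  moreover have "0 \<le> D * ((int d - 2) * (int d + 1) * t)" using D_pos t1 d4 by simp
  ultimately show "0 \<le> corner i" "corner i < N" using N_pos by (auto simp: corner_def)
qed

text \<open>The entries represent \<open>- D * T i\<close> modulo \<open>N\<close>: this is
  \<open>0\<close> at \<open>ib\<close> since \<open>p\<close> divides \<open>T ib\<close>, and at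
  \<open>ia\<close> the value follows from the sum of all \<open>T i\<close> being
  \<open>N\<close>.\<close>

lemma corner_lattice: "N dvd corner i + D * T i"
proof -
  have ib: "N dvd D * T ib" using p_T by (simp add: N_def mult_dvd_mono)
  consider "i = ib" | "i = ia" | "i \<noteq> ia" "i \<noteq> ib" by blast
  then show ?thesis
  proof cases
    case 1 then show ?thesis using ib by (simp add: corner_def)
  next
    case 2
    have "sum T (UNIV - {ia, ib}) = (\<Sum>i\<in>UNIV - {ia, ib}. (int d + 1) * t)"
      by (rule sum.cong) (auto simp: single_T)
    then have Tia: "T ia = N - T ib - (int d - 2) * ((int d + 1) * t)"
      using sum_T by (simp add: sum_split card_singles int_d2)
    have "corner ia + D * T ia = N * D - D * T ib"
      using ia_ib by (simp add: corner_def Tia algebra_simps)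
    then show ?thesis using 2 ib by (metis dvd_diff dvd_triv_left)
  next
    case 3 then show ?thesis by (simp add: corner_def single_T)
  qed
qed

lemma corner_sum: "sum corner UNIV = N * (int d - 2)"
proof -
  have "sum corner (UNIV - {ia, ib}) = (\<Sum>i\<in>UNIV - {ia, ib}. N - D * ((int d + 1) * t))"
    by (rule sum.cong) (auto simp: corner_def)
  then show ?thesis
    using ia_ib by (simp add: sum_split card_singles int_d2 corner_def algebra_simps)
qed

text \<open>Adding the lower vertex over \<open>ia\<close> preserves both the facet and the height,
  so the degree can be raised to a multiple of any \<open>k\<close>.\<close>

lemma S_corner_plus: "S (d - 2 + m) (\<lambda>i. corner i + int m * vert ia i) D"
proof (rule S_intro[where g = 0])
  show "N dvd (corner i + int m * vert ia i) - D * \<alpha> i * 0 + D * T i" for i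
  proof -
    have "N dvd (corner i + D * T i) + int m * vert ia i"
      by (intro dvd_add[OF corner_lattice]) (auto simp: vert_def)
    then show ?thesis by (simp add: algebra_simps)
  qed
  show "0 \<le> corner i + int m * vert ia i" for i
    using corner_bounds[of i] N_pos by (simp add: vert_def)
  have "(\<Sum>i\<in>UNIV. int m * vert ia i) = int m * N" by (simp add: vert_def flip: sum_distrib_left)
  then show "(\<Sum>i\<in>UNIV. corner i + int m * vert ia i) = N * int (d - 2 + m)"
    using corner_sum d4 by (simp add: sum.distrib of_nat_diff algebra_simps)
  have "D * 1 \<le> D * (p * int (d - 2 + m))"
    using D_pos p_pos d4 by (intro mult_left_mono) (auto simp: int_one_le_iff_zero_less)
  then show "D \<le> N * int (d - 2 + m)" by (simp add: N_def mult.assoc)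
qed (use D_pos in simp)

text \<open>Modulo \<open>D\<close> the lattice condition at \<open>ib\<close> reduces to
  \<open>D dvd u * T ib\<close>, and \<open>T ib\<close> is coprime to \<open>D\<close>.\<close>

lemma facet_height_dvd:
  assumes "S k \<sigma> u" "\<sigma> ib = 0"
  shows "D dvd u"
proof -
  obtain g where "N dvd \<sigma> ib - D * \<alpha> ib * g + u * T ib" using assms unfolding S_def by blast
  then have "D dvd \<sigma> ib - D * \<alpha> ib * g + u * T ib" unfolding N_def by (rule dvd_mult_left)
  then have "D dvd D * g + u * T ib" by (simp add: alpha_ib assms(2))
  then have "D dvd u * T ib" by (simp add: dvd_add_right_iff)
  then show ?thesis using T_cop by (simp add: coprime_commute coprime_dvd_mult_left_iff)
qed

text \<open>At height \<open>D\<close> the condition at \<open>ib\<close> forces the zero class, so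
  \<open>\<sigma>\<close> agrees with \<open>corner\<close> modulo \<open>N\<close>. The entries of
  \<open>corner\<close> are reduced, hence lie below those of \<open>\<sigma>\<close>.\<close>

lemma facet_height_D_degree:
  assumes S: "S k \<sigma> D" and "\<sigma> ib = 0"
  shows "d - 2 \<le> k"
proof -
  obtain g where g: "\<And>i. N dvd \<sigma> i - D * \<alpha> i * g + D * T i" using S unfolding S_def by blast
  have "D * p dvd D * (g + T ib)" using g[of ib] assms(2) by (simp add: alpha_ib N_def algebra_simps)
  then have "p dvd g + T ib" using D_pos by simp
  then have "p dvd g" using p_T by (simp add: dvd_add_left_iff)
  then have Ng: "N dvd D * \<alpha> i * g" for i by (simp add: N_def mult_dvd_mono)
  have "corner i \<le> \<sigma> i" for i
  proof -
    have "N dvd (\<sigma> i - D * \<alpha> i * g + D * T i) + D * \<alpha> i * g - (corner i + D * T i)"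
      using g[of i] Ng[of i] corner_lattice[of i] by (simp only: dvd_add dvd_diff)
    then have "N dvd \<sigma> i - corner i" by simp
    then have "\<sigma> i mod N = corner i mod N" by (simp add: mod_eq_dvd_iff)
    then have "\<sigma> i mod N = corner i" using corner_bounds[of i] by simp
    moreover have "0 \<le> \<sigma> i" using S by (simp add: S_def)
    ultimately show ?thesis using N_pos by (metis zmod_le_nonneg_dividend)
  qed
  then have "sum corner UNIV \<le> sum \<sigma> UNIV" by (intro sum_mono)
  then have "N * (int d - 2) \<le> N * int k" using S by (simp add: corner_sum S_def)
  then have "int d - 2 \<le> int k" using N_pos by (metis mult_le_cancel_left_pos)
  then show ?thesis by linarith
qed

text \<open>All summands lie in the facet, so their heights are multiples of \<open>D\<close>. As
  the heights add up to \<open>D\<close>, one summand has height \<open>D\<close> and therefore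
  degree at least \<open>d - 2\<close>.\<close>

lemma corner_plus_not_sum:
  fixes \<sigma> :: "nat \<Rightarrow> 'n \<Rightarrow> int" and u :: "nat \<Rightarrow> int"
  assumes "\<And>j. j < n \<Longrightarrow> S k (\<sigma> j) (u j)" and "k < d - 2"
    and "\<And>i. (\<Sum>j<n. \<sigma> j i) = corner i + int m * vert ia i" and "(\<Sum>j<n. u j) = D"
  shows False
proof -
  have \<sigma>0: "0 \<le> \<sigma> j i" and u0: "0 \<le> u j" if "j < n" for i j using assms(1)[OF that] by (auto simp: S_def)
  have "(\<Sum>j<n. \<sigma> j ib) = 0" using assms(3)[of ib] ia_ib by (simp add: corner_def vert_def)
  then have ib0: "\<sigma> j ib = 0" if "j < n" for j
    using \<sigma>0 that by (subst (asm) sum_nonneg_eq_0_iff) auto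
  have "\<exists>j<n. u j \<noteq> 0"
  proof (rule ccontr)
    assume "\<not> ?thesis"
    then have "(\<Sum>j<n. u j) = 0" by simp
    then show False using assms(4) D_pos by simp
  qed
  then obtain j where j: "j < n" "u j \<noteq> 0" by blast
  have "u j \<le> (\<Sum>j<n. u j)" using j u0 by (intro member_le_sum) auto
  then have "u j \<le> D" using assms(4) by simp
  moreover have "D \<le> u j"
    using facet_height_dvd[OF assms(1)[OF j(1)] ib0[OF j(1)]] u0[OF j(1)] j(2)
    by (intro zdvd_imp_le) auto
  ultimately have "u j = D" by simp
  then have "d - 2 \<le> k" using facet_height_D_degree[of k "\<sigma> j"] assms(1)[OF j(1)] ib0[OF j(1)] by simp
  then show False using assms(2) by simp
qed

end

end

subsection \<open>Hilbert bases and dilated polytopes\<close>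

definition dil_lattice :: "(real^'n) set \<Rightarrow> nat \<Rightarrow> (real^'n) set" where
  "dil_lattice P n = dilate n P \<inter> lattice_pts"

lemma lattice_pts_add: "x \<in> lattice_pts \<Longrightarrow> y \<in> lattice_pts \<Longrightarrow> x + y \<in> lattice_pts"
  by (auto simp: lattice_pts_def)

lemma dilate_add:
  fixes P :: "(real^'n) set"
  assumes "convex P" "x \<in> dilate m P" "y \<in> dilate n P"
  shows "x + y \<in> dilate (m + n) P"
proof (cases "m + n = 0")
  case True
  then show ?thesis using assms by (auto simp: dilate_def)
next
  case False
  obtain a b where ab: "a \<in> P" "b \<in> P" "x = real m *\<^sub>R a" "y = real n *\<^sub>R b"
    using assms by (auto simp: dilate_def)
  let ?s = "real m + real n"
  have s: "?s > 0" using False by linarith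
  have "(real m / ?s) *\<^sub>R a + (real n / ?s) *\<^sub>R b \<in> P"
    using assms(1) ab s by (intro convexD) (auto simp: add_divide_distrib[symmetric])
  moreover have "x + y = ?s *\<^sub>R ((real m / ?s) *\<^sub>R a + (real n / ?s) *\<^sub>R b)"
    using s ab by (simp add: scaleR_add_right)
  ultimately show ?thesis by (auto simp: dilate_def)
qed

lemma dil_lattice_add:
  "convex P \<Longrightarrow> x \<in> dil_lattice P m \<Longrightarrow> y \<in> dil_lattice P n \<Longrightarrow> x + y \<in> dil_lattice P (m + n)"
  by (auto simp: dil_lattice_def intro: dilate_add lattice_pts_add)

lemma dil_lattice_0: "P \<noteq> {} \<Longrightarrow> dil_lattice P 0 = {0}"
  by (auto simp: dil_lattice_def dilate_def lattice_pts_def)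

lemma dil_lattice_sum:
  assumes "convex P" "P \<noteq> {}" "\<And>i. i < m \<Longrightarrow> a i \<in> dil_lattice P k"
  shows "(\<Sum>i<m. a i) \<in> dil_lattice P (m * k)"
  using assms(3)
proof (induction m)
  case 0
  then show ?case using assms(2) by (simp add: dil_lattice_0)
next
  case (Suc m)
  then show ?case using dil_lattice_add[OF assms(1), of "\<Sum>i<m. a i" "m * k" "a m" k] 
    by (simp add: add.commute)
qed

lemma finite_dil_lattice:
  assumes "bounded P"
  shows "finite (dil_lattice P n)"
proof -
  have "bounded (dilate n P)" unfolding dilate_def using assms by (rule bounded_scaling)
  then obtain B where B: "\<And>x. x \<in> dilate n P \<Longrightarrow> norm x \<le> B" by (auto simp: bounded_iff)
  let ?A = "real_of_int ` {- \<lceil>B\<rceil>..\<lceil>B\<rceil>}"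
  have "dil_lattice P n \<subseteq> (\<lambda>f. \<chi> i. f i) ` (PiE UNIV (\<lambda>_. ?A))"
  proof
    fix x assume x: "x \<in> dil_lattice P n"
    have "x $ i \<in> ?A" for i
    proof -
      obtain k where k: "x $ i = of_int k"
        using x by (auto simp: dil_lattice_def lattice_pts_def Ints_def)
      have "\<bar>x $ i\<bar> \<le> B" using component_le_norm_cart[of x i] B[of x] x by (auto simp: dil_lattice_def)
      then have "k \<in> {- \<lceil>B\<rceil>..\<lceil>B\<rceil>}" unfolding k by (simp; linarith)
      then show ?thesis using k by blast
    qed
    then show "x \<in> (\<lambda>f. \<chi> i. f i) ` (PiE UNIV (\<lambda>_. ?A))"
      by (intro image_eqI[of _ _ "\<lambda>i. x $ i"]) auto
  qed
  then show ?thesis by (rule finite_subset) (intro finite_imageI finite_PiE, auto)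
qed

text \<open>By Krein-Milman the extreme points generate all of \<open>P\<close> in degree one;
  conversely, convexity of \<open>P\<close> makes the right-hand side a convex cone.\<close>

lemma cone_of_eq:
  fixes P :: "(real^'n) set"
  assumes "compact P" "convex P" "P \<noteq> {}"
  shows "cone_of P = {(k *\<^sub>R v, k) | k v. 0 \<le> k \<and> v \<in> P}" (is "_ = ?K")
proof
  have mem: "(k *\<^sub>R v, k) \<in> ?K" if "0 \<le> k" "v \<in> P" for k v using that by blast
  have "convex_cone ?K"
    unfolding convex_cone_iff
  proof (intro conjI ballI allI impI)
    obtain v where "v \<in> P" using assms(3) by blast
    then show "0 \<in> ?K" using mem[of 0 v] by (simp add: zero_prod_def)
  next
    fix x y assume "x \<in> ?K" "y \<in> ?K"
    then obtain k v l w where kv: "x = (k *\<^sub>R v, k)" "0 \<le> k" "v \<in> P" "y = (l *\<^sub>R w, l)" "0 \<le> l" "w \<in> P"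
      by blast
    show "x + y \<in> ?K"
    proof (cases "k + l = 0")
      case True
      then have "k = 0" "l = 0" using kv by auto
      then show ?thesis using kv mem[of 0 v] by simp
    next
      case False
      then have s: "k + l > 0" using kv by simp
      have "(k / (k + l)) *\<^sub>R v + (l / (k + l)) *\<^sub>R w \<in> P"
        using assms(2) kv s by (intro convexD) (auto simp: add_divide_distrib[symmetric])
      then have "((k + l) *\<^sub>R ((k / (k + l)) *\<^sub>R v + (l / (k + l)) *\<^sub>R w), k + l) \<in> ?K"
        using s by (intro mem) auto
      then show ?thesis using s kv by (simp add: scaleR_add_right)
    qed
  next
    fix x and c :: real assume "x \<in> ?K" "0 \<le> c"
    then obtain k v where "x = (k *\<^sub>R v, k)" "0 \<le> k" "v \<in> P" by blast
    then show "c *\<^sub>R x \<in> ?K" using mem[of "c * k" v] \<open>0 \<le> c\<close> by simp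
  qed
  moreover have "{(v, 1) | v. v extreme_point_of P} \<subseteq> ?K"
  proof clarify
    fix v assume "v extreme_point_of P"
    then have "v \<in> P" by (simp add: extreme_point_of_def)
    then show "\<exists>k va. (v, 1) = (k *\<^sub>R va, k) \<and> 0 \<le> k \<and> va \<in> P"
      by (intro exI[of _ 1] exI[of _ v]) simp
  qed
  ultimately show "cone_of P \<subseteq> ?K" unfolding cone_of_def by (intro hull_minimal)
  show "?K \<subseteq> cone_of P"
  proof clarify
    fix k :: real and v assume kv: "0 \<le> k" "v \<in> P"
    let ?X = "{x. x extreme_point_of P}"
    have X: "{(v, 1) | v. v extreme_point_of P} = ?X \<times> {1::real}" by auto
    have "v \<in> convex hull ?X" using kv Krein_Milman_Minkowski[OF assms(1,2)] by simp
    then have "(v, 1) \<in> convex hull (?X \<times> {1::real})" by (simp add: convex_hull_Times)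
    then have "(v, 1) \<in> cone_of P"
      unfolding cone_of_def X using convex_hull_subset_convex_cone_hull by blast
    then have "k *\<^sub>R (v, 1) \<in> cone_of P" unfolding cone_of_def using kv by (intro convex_cone_hull_mul)
    then show "(k *\<^sub>R v, k) \<in> cone_of P" by simp
  qed
qed

lemma cone_lattice_iff:
  fixes P :: "(real^'n) set"
  assumes "compact P" "convex P" "P \<noteq> {}"
  shows "z \<in> cone_of P \<inter> lattice_pts1 \<longleftrightarrow> (\<exists>n v. z = (v, real n) \<and> v \<in> dil_lattice P n)"
proof
  assume "z \<in> cone_of P \<inter> lattice_pts1"
  then obtain k v where z: "z = (k *\<^sub>R v, k)" "0 \<le> k" "v \<in> P" "k *\<^sub>R v \<in> lattice_pts" "k \<in> \<int>"
    unfolding cone_of_eq[OF assms] by (auto simp: lattice_pts1_def)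
  then obtain n where "k = real n" by (metis Ints_cases nonneg_int_cases of_int_0_le_iff of_int_of_nat_eq)
  then show "\<exists>n v. z = (v, real n) \<and> v \<in> dil_lattice P n"
    using z by (auto simp: dil_lattice_def dilate_def)
next
  assume "\<exists>n v. z = (v, real n) \<and> v \<in> dil_lattice P n"
  then show "z \<in> cone_of P \<inter> lattice_pts1"
    unfolding cone_of_eq[OF assms] by (fastforce simp: dil_lattice_def dilate_def lattice_pts1_def)
qed

definition reducible :: "(real^'n) set \<Rightarrow> nat \<Rightarrow> real^'n \<Rightarrow> bool" where
  "reducible P n v \<longleftrightarrow> (\<exists>j x. 1 \<le> j \<and> j < n \<and> x \<in> dil_lattice P j \<and> v - x \<in> dil_lattice P (n - j))"

definition irreducibles :: "(real^'n) set \<Rightarrow> ((real^'n) \<times> real) set" where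
  "irreducibles P = {(v, real n) | v n. 1 \<le> n \<and> v \<in> dil_lattice P n \<and> \<not> reducible P n v}"

text \<open>Strong induction on the degree: a reducible element splits into two of smaller
  degree.\<close>

lemma hilbert_basis_irreducibles:
  fixes P :: "(real^'n) set"
  assumes P: "compact P" "convex P" "P \<noteq> {}" and fin: "finite (irreducibles P)"
  shows "hilbert_basis (cone_of P) (irreducibles P)"
proof -
  let ?I = "irreducibles P"
  have "\<exists>c :: _ \<Rightarrow> nat. (v, real n) = (\<Sum>h\<in>?I. real (c h) *\<^sub>R h)" if "v \<in> dil_lattice P n" for v n
    using that
  proof (induction n arbitrary: v rule: less_induct)
    case (less n)
    show ?case
    proof (cases "n = 0")
      case True
      then show ?thesis
        using less.prems P(3) by (intro exI[of _ "\<lambda>_. 0"]) (simp add: dil_lattice_0 flip: zero_prod_def)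
    next
      case n: False
      show ?thesis
      proof (cases "reducible P n v")
        case True
        then obtain j x where j: "1 \<le> j" "j < n" "x \<in> dil_lattice P j" "v - x \<in> dil_lattice P (n - j)"
          by (auto simp: reducible_def)
        obtain c where c: "(x, real j) = (\<Sum>h\<in>?I. real (c h) *\<^sub>R h)"
          using less.IH[OF j(2,3)] by blast
        obtain c' where c': "(v - x, real (n - j)) = (\<Sum>h\<in>?I. real (c' h) *\<^sub>R h)"
          using less.IH[of "n - j" "v - x"] j by auto
        have "(v, real n) = (x, real j) + (v - x, real (n - j))" using j by (simp add: of_nat_diff)
        also have "\<dots> = (\<Sum>h\<in>?I. real (c h + c' h) *\<^sub>R h)"
          unfolding c c' by (simp add: sum.distrib scaleR_add_left)
        finally show ?thesis by (rule exI[of _ "\<lambda>h. c h + c' h"])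
      next
        case False
        then have I: "(v, real n) \<in> ?I" using n less.prems by (auto simp: irreducibles_def)
        have "(\<Sum>h\<in>?I. real (if h = (v, real n) then 1 else 0) *\<^sub>R h) = (v, real n)"
          using I fin by (simp add: if_distrib[of "\<lambda>a. a *\<^sub>R _"] if_distrib[of real] sum.delta' cong: if_cong)
        then show ?thesis by (intro exI[of _ "\<lambda>h. if h = (v, real n) then 1 else 0"]) simp
      qed
    qed
  qed
  then have "\<exists>c :: _ \<Rightarrow> nat. z = (\<Sum>h\<in>?I. real (c h) *\<^sub>R h)" if "z \<in> cone_of P \<inter> lattice_pts1" for z
    using that unfolding cone_lattice_iff[OF P] by blast
  moreover have "z \<in> cone_of P \<inter> lattice_pts1" if "z \<in> ?I" for z
    using that unfolding cone_lattice_iff[OF P] irreducibles_def by blast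
  ultimately show ?thesis using fin unfolding hilbert_basis_def by blast
qed

text \<open>From a combination of \<open>H\<close> that yields an irreducible element, one summand
  of positive degree is taken out. The rest must then have degree \<open>0\<close>, so it
  vanishes.\<close>

lemma irreducibles_subset_hilbert_basis:
  fixes P :: "(real^'n) set"
  assumes P: "compact P" "convex P" "P \<noteq> {}" and H: "hilbert_basis (cone_of P) H"
  shows "irreducibles P \<subseteq> H"
proof
  fix z assume "z \<in> irreducibles P"
  then obtain v n where z: "z = (v, real n)" "1 \<le> n" "v \<in> dil_lattice P n" "\<not> reducible P n v"
    by (auto simp: irreducibles_def)
  have finH: "finite H" using H by (simp add: hilbert_basis_def)
  have HL: "\<exists>n v. h = (v, real n) \<and> v \<in> dil_lattice P n" if "h \<in> H" for h
    using that H cone_lattice_iff[OF P, of h] unfolding hilbert_basis_def by blast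
  have scale: "\<exists>n v. real k *\<^sub>R h = (v, real n) \<and> v \<in> dil_lattice P n" if hH: "h \<in> H" for h and k :: nat
  proof -
    obtain m w where m: "h = (w, real m)" "w \<in> dil_lattice P m" using HL[OF hH] by blast
    have "(\<Sum>i<k. w) \<in> dil_lattice P (k * m)" using m by (intro dil_lattice_sum P) auto
    then have "real k *\<^sub>R w \<in> dil_lattice P (k * m)" by (simp only: sum_constant_scaleR card_lessThan)
    then show ?thesis using m by (intro exI[of _ "k * m"] exI[of _ "real k *\<^sub>R w"]) simp
  qed
  have sums: "\<exists>n v. (\<Sum>h\<in>G. real (c h) *\<^sub>R h) = (v, real n) \<and> v \<in> dil_lattice P n"
    if "G \<subseteq> H" for G and c :: "_ \<Rightarrow> nat"
    using finite_subset[OF that finH] that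
  proof (induction G rule: finite_induct)
    case empty
    then show ?case using P(3) by (intro exI[of _ 0] exI[of _ "0::real^'n"]) (simp add: dil_lattice_0 flip: zero_prod_def)
  next
    case (insert g G)
    then obtain m w where m: "(\<Sum>h\<in>G. real (c h) *\<^sub>R h) = (w, real m)" "w \<in> dil_lattice P m" by blast
    obtain k y where k: "real (c g) *\<^sub>R g = (y, real k)" "y \<in> dil_lattice P k"
      using scale[of g "c g"] insert by blast
    have "(\<Sum>h\<in>insert g G. real (c h) *\<^sub>R h) = (y + w, real (k + m))" using insert m k by simp
    then show ?case using dil_lattice_add[OF P(2) k(2) m(2)] by blast
  qed
  obtain c :: "_ \<Rightarrow> nat" where c: "z = (\<Sum>h\<in>H. real (c h) *\<^sub>R h)"
    using H z cone_lattice_iff[OF P, of z] unfolding hilbert_basis_def by blast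
  \<comment> \<open>\<open>H\<close> may contain the zero vector, so a nonzero coefficient alone
    does not give a summand of positive degree.\<close>
  have "\<exists>h\<in>H. c h \<noteq> 0 \<and> snd h \<noteq> 0"
  proof (rule ccontr)
    assume "\<not> ?thesis"
    then have "snd (real (c h) *\<^sub>R h) = 0" if "h \<in> H" for h using that by auto
    then have "(\<Sum>h\<in>H. snd (real (c h) *\<^sub>R h)) = 0" by (intro sum.neutral) blast
    then have "snd z = 0" unfolding c by (simp add: snd_sum)
    then show False using z by simp
  qed
  then obtain h where h: "h \<in> H" "c h \<noteq> 0" "snd h \<noteq> 0" by blast
  obtain m w where m: "h = (w, real m)" "w \<in> dil_lattice P m" using HL[OF h(1)] by blast
  obtain k y where k: "(\<Sum>g\<in>H. real ((c(h := c h - 1)) g) *\<^sub>R g) = (y, real k)" "y \<in> dil_lattice P k"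
    using sums[of H "c(h := c h - 1)"] by blast
  have "z = h + (\<Sum>g\<in>H. real ((c(h := c h - 1)) g) *\<^sub>R g)"
  proof -
    have "(\<Sum>g\<in>H. real ((c(h := c h - 1)) g) *\<^sub>R g)
        = real (c h - 1) *\<^sub>R h + (\<Sum>g\<in>H - {h}. real (c g) *\<^sub>R g)"
      using finH h by (subst sum.remove[of _ h]) auto
    moreover have "z = real (c h) *\<^sub>R h + (\<Sum>g\<in>H - {h}. real (c g) *\<^sub>R g)"
      unfolding c using finH h by (subst sum.remove[of _ h]) auto
    moreover have "real (c h) *\<^sub>R h = (1 + real (c h - 1)) *\<^sub>R h" using h by simp
    then have "real (c h) *\<^sub>R h = h + real (c h - 1) *\<^sub>R h" by (simp only: scaleR_add_left scaleR_one)
    ultimately show ?thesis by (simp only: add.assoc)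
  qed
  then have vn: "v = w + y" "n = m + k" using z m k by (auto simp flip: of_nat_add)
  have "m \<ge> 1" using h m by (cases m) auto
  have "k = 0"
  proof (rule ccontr)
    assume "k \<noteq> 0"
    then have "reducible P n v"
      unfolding reducible_def using vn m k \<open>m \<ge> 1\<close> by (intro exI[of _ m] exI[of _ w]) auto
    then show False using z by simp
  qed
  then have "z = h" using vn k z m P(3) by (simp add: dil_lattice_0)
  then show "z \<in> H" using h by simp
qed

text \<open>The irreducible elements form a Hilbert basis contained in every other one, hence the
  unique minimal one.\<close>

lemma mu_Hilb_eq:
  fixes P :: "(real^'n) set"
  assumes P: "compact P" "convex P" "P \<noteq> {}" and B: "1 \<le> B"
    and red: "\<And>n v. B < n \<Longrightarrow> v \<in> dil_lattice P n \<Longrightarrow> reducible P n v"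
    and irr: "h \<in> dil_lattice P B" "\<not> reducible P B h"
  shows "mu_Hilb P = real B"
proof -
  let ?I = "irreducibles P"
  have "?I \<subseteq> (\<Union>n\<in>{..B}. (\<lambda>v. (v, real n)) ` dil_lattice P n)"
  proof
    fix z assume "z \<in> ?I"
    then obtain v n where z: "z = (v, real n)" "v \<in> dil_lattice P n" "\<not> reducible P n v"
      by (auto simp: irreducibles_def)
    then have "n \<le> B" using red by (meson not_le)
    then show "z \<in> (\<Union>n\<in>{..B}. (\<lambda>v. (v, real n)) ` dil_lattice P n)" using z by blast
  qed
  moreover have "finite (\<Union>n\<in>{..B}. (\<lambda>v. (v, real n)) ` dil_lattice P n)"
    using finite_dil_lattice compact_imp_bounded[OF P(1)] by blast
  ultimately have fin: "finite ?I" by (rule finite_subset)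
  have HB: "hilbert_basis (cone_of P) ?I" by (rule hilbert_basis_irreducibles[OF P fin])
  have "(THE H. minimal_hilbert_basis (cone_of P) H) = ?I"
  proof (rule the_equality)
    show "minimal_hilbert_basis (cone_of P) ?I"
      unfolding minimal_hilbert_basis_def
      using HB irreducibles_subset_hilbert_basis[OF P] by blast
    fix H assume "minimal_hilbert_basis (cone_of P) H"
    then show "H = ?I"
      unfolding minimal_hilbert_basis_def
      using HB irreducibles_subset_hilbert_basis[OF P] by blast
  qed
  moreover have "Max (snd ` ?I) = real B"
  proof (rule Max_eqI)
    show "finite (snd ` ?I)" using fin by simp
    show "y \<le> real B" if y: "y \<in> snd ` ?I" for y
    proof -
      obtain z where "z \<in> ?I" "y = snd z" using y by blast
      then obtain v n where "y = real n" "v \<in> dil_lattice P n" "\<not> reducible P n v"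
        by (auto simp: irreducibles_def)
      then have "n \<le> B" using red by (meson not_le)
      then show ?thesis using \<open>y = real n\<close> by simp
    qed
    have "(h, real B) \<in> ?I" using irr B by (auto simp: irreducibles_def)
    then show "real B \<in> snd ` ?I" by force
  qed
  ultimately show ?thesis by (simp add: mu_Hilb_def)
qed

section \<open>From splittings to the values of the invariants\<close>

lemma IDP_dilate_iff:
  fixes P :: "(real^'n) set"
  shows "IDP (dilate k P) \<longleftrightarrow> (\<forall>m\<ge>1. \<forall>\<alpha>\<in>dil_lattice P (m * k).
     \<exists>a. (\<forall>j<m. a j \<in> dil_lattice P k) \<and> \<alpha> = (\<Sum>j<m. a j))"
proof -
  have "dilate m (dilate k P) = dilate (m * k) P" for m by (auto simp: dilate_def image_image)
  then show ?thesis unfolding IDP_def dil_lattice_def by simp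
qed

lemma IDP_dilate_if_split:
  fixes P :: "(real^'n) set"
  assumes "\<And>m \<alpha>. 1 \<le> m \<Longrightarrow> \<alpha> \<in> dil_lattice P (m * k + k) \<Longrightarrow>
      \<exists>x\<in>dil_lattice P k. \<alpha> - x \<in> dil_lattice P (m * k)"
  shows "IDP (dilate k P)"
  unfolding IDP_dilate_iff
proof (intro allI impI ballI)
  fix m :: nat and \<alpha> assume "1 \<le> m" "\<alpha> \<in> dil_lattice P (m * k)"
  then show "\<exists>a. (\<forall>j<m. a j \<in> dil_lattice P k) \<and> \<alpha> = (\<Sum>j<m. a j)"
  proof (induction m arbitrary: \<alpha> rule: dec_induct)
    case base
    then show ?case by (intro exI[of _ "\<lambda>_. \<alpha>"]) simp
  next
    case (step m)
    then obtain x where x: "x \<in> dil_lattice P k" "\<alpha> - x \<in> dil_lattice P (m * k)"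
      using assms[of m \<alpha>] by (auto simp: add.commute)
    then obtain a where a: "\<forall>j<m. a j \<in> dil_lattice P k" "\<alpha> - x = (\<Sum>j<m. a j)" using step.IH by blast
    have "\<alpha> = (\<Sum>j<Suc m. (a(m := x)) j)" using a by (simp add: algebra_simps)
    then show ?case using a x by (intro exI[of _ "a(m := x)"]) auto
  qed
qed

text \<open>For \<open>k \<ge> d - 1\<close>, peeling off \<open>k\<close> elements of degree one
  gives IDP of the \<open>k\<close>-th dilate. For \<open>k = d - 2\<close> this fails to reach only
  degree \<open>2 * (d - 2)\<close>, where the splitting \<open>mid\<close> of degree
  \<open>d\<close> takes over.\<close>

lemma mu_values:
  fixes P :: "(real^'n) set" and d :: nat
  assumes P: "compact P" "convex P" "P \<noteq> {}" and d: "4 \<le> d"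
    and unit: "\<And>n v. d \<le> Suc n \<Longrightarrow> v \<in> dil_lattice P (Suc n) \<Longrightarrow>
      \<exists>x\<in>dil_lattice P 1. v - x \<in> dil_lattice P n"
    and mid: "\<And>v. v \<in> dil_lattice P d \<Longrightarrow>
      \<exists>j x. 2 \<le> j \<and> j \<le> d - 2 \<and> x \<in> dil_lattice P j \<and> v - x \<in> dil_lattice P (d - j)"
    and irr: "h \<in> dil_lattice P (d - 1)" "\<not> reducible P (d - 1) h"
    and bad: "\<And>k. 5 \<le> d \<Longrightarrow> 1 \<le> k \<Longrightarrow> k < d - 2 \<Longrightarrow> \<not> IDP (dilate k P)"
  shows "mu_Hilb P = real (d - 1)" "mu_midp P = d - 2" "mu_idp P = d - 2"
proof -
  have units: "\<exists>a. (\<forall>i<j. a i \<in> dil_lattice P 1) \<and> v - (\<Sum>i<j. a i) \<in> dil_lattice P n"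
    if n: "d \<le> Suc n" and v: "v \<in> dil_lattice P (n + j)" for n j v
    using v
  proof (induction j arbitrary: v)
    case 0
    then show ?case by simp
  next
    case (Suc j)
    obtain x where x: "x \<in> dil_lattice P 1" "v - x \<in> dil_lattice P (n + j)"
      using unit[of "n + j" v] Suc.prems n by auto
    obtain a where a: "\<forall>i<j. a i \<in> dil_lattice P 1" "v - x - (\<Sum>i<j. a i) \<in> dil_lattice P n"
      using Suc.IH[OF x(2)] by blast
    show ?case using a x by (intro exI[of _ "a(j := x)"]) (auto simp: less_Suc_eq algebra_simps)
  qed
  have part: "(\<Sum>i<j. a i) \<in> dil_lattice P j" if "\<forall>i<j. a i \<in> dil_lattice P 1" for a j
    using dil_lattice_sum[OF P(2,3), of j a 1] that by simp
  show "mu_Hilb P = real (d - 1)"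
  proof (rule mu_Hilb_eq[OF P _ _ irr])
    fix n v assume n: "d - 1 < n" "v \<in> dil_lattice P n"
    then obtain n' where n': "n = Suc n'" by (cases n) auto
    have "d \<le> Suc n'" using n n' by linarith
    then obtain x where "x \<in> dil_lattice P 1" "v - x \<in> dil_lattice P n'"
      using unit[of n' v] n n' by auto
    then show "reducible P n v"
      unfolding reducible_def using n n' d by (intro exI[of _ 1] exI[of _ x]) auto
  qed (use d in simp)
  have big: "IDP (dilate k P)" if k: "d - 1 \<le> k" for k
  proof (rule IDP_dilate_if_split)
    fix m \<alpha> assume m: "1 \<le> m" "\<alpha> \<in> dil_lattice P (m * k + k)"
    have "1 * k \<le> m * k" using m by (intro mult_right_mono) auto
    then have "d \<le> Suc (m * k)" using k by linarith
    then obtain a where "\<forall>i<k. a i \<in> dil_lattice P 1" "\<alpha> - (\<Sum>i<k. a i) \<in> dil_lattice P (m * k)"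
      using units[of "m * k" \<alpha> k] m by auto
    then show "\<exists>x\<in>dil_lattice P k. \<alpha> - x \<in> dil_lattice P (m * k)" using part by blast
  qed
  have main: "IDP (dilate (d - 2) P)"
  proof (rule IDP_dilate_if_split)
    fix m \<alpha> assume m: "1 \<le> m" "\<alpha> \<in> dil_lattice P (m * (d - 2) + (d - 2))"
    show "\<exists>x\<in>dil_lattice P (d - 2). \<alpha> - x \<in> dil_lattice P (m * (d - 2))"
    proof (cases "m = 1")
      case False
      then have "2 * (d - 2) \<le> m * (d - 2)" using m by (intro mult_right_mono) auto
      then have "d \<le> Suc (m * (d - 2))" using d by linarith
      then obtain a where "\<forall>i<d - 2. a i \<in> dil_lattice P 1"
          "\<alpha> - (\<Sum>i<d - 2. a i) \<in> dil_lattice P (m * (d - 2))"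
        using units[of "m * (d - 2)" \<alpha> "d - 2"] m by auto
      then show ?thesis using part by blast
    next
      case True
      have "m * (d - 2) + (d - 2) = d + (d - 4)" using True d by simp
      then obtain a where a: "\<forall>i<d - 4. a i \<in> dil_lattice P 1" "\<alpha> - (\<Sum>i<d - 4. a i) \<in> dil_lattice P d"
        using units[of d \<alpha> "d - 4"] m by auto
      obtain j y where j: "2 \<le> j" "j \<le> d - 2" "y \<in> dil_lattice P j"
          "\<alpha> - (\<Sum>i<d - 4. a i) - y \<in> dil_lattice P (d - j)"
        using mid[OF a(2)] by blast
      \<comment> \<open>The \<open>d - 4\<close> peeled elements are dealt out so that both parts
        reach degree \<open>d - 2\<close>.\<close>
      let ?A = "\<Sum>i<d - 2 - j. a i" and ?B = "\<Sum>i<j - 2. a (d - 2 - j + i)"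
      have "?A \<in> dil_lattice P (d - 2 - j)" using a j by (intro part) auto
      then have x: "y + ?A \<in> dil_lattice P (d - 2)"
        using dil_lattice_add[OF P(2) j(3)] j(2) by (metis le_add_diff_inverse)
      have "?B \<in> dil_lattice P (j - 2)" using a j by (intro part) auto
      then have "\<alpha> - (\<Sum>i<d - 4. a i) - y + ?B \<in> dil_lattice P (d - j + (j - 2))"
        by (rule dil_lattice_add[OF P(2) j(4)])
      then have y: "\<alpha> - (\<Sum>i<d - 4. a i) - y + ?B \<in> dil_lattice P (m * (d - 2))"
        using j True d by simp
      have "d - 4 = (d - 2 - j) + (j - 2)" using j d by simp
      moreover have "(\<Sum>i<x + y. a i) = (\<Sum>i<x. a i) + (\<Sum>i<y. a (x + i))" for x y
        by (induction y) (simp_all add: add.assoc)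
      ultimately have "(\<Sum>i<d - 4. a i) = ?A + ?B" by simp
      then have "\<alpha> - (y + ?A) \<in> dil_lattice P (m * (d - 2))" using y by (simp add: algebra_simps)
      then show ?thesis using x by blast
    qed
  qed
  have small: "\<not> IDP (dilate k P)" if k: "1 \<le> k" "k < d - 2" for k
  proof (cases "5 \<le> d")
    case True then show ?thesis using bad k by blast
  next
    case False
    \<comment> \<open>For \<open>d = 4\<close> only \<open>P\<close> itself is left; its irreducible
      element of degree \<open>3\<close> is not a sum of three elements of degree one.\<close>
    then have k1: "k = 1" and d4: "d = 4" using d k by auto
    show ?thesis
    proof
      assume "IDP (dilate k P)"
      then have *: "\<forall>m\<ge>1. \<forall>\<alpha>\<in>dil_lattice P m. \<exists>a. (\<forall>j<m. a j \<in> dil_lattice P 1) \<and> \<alpha> = (\<Sum>j<m. a j)"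
        unfolding IDP_dilate_iff k1 by simp
      have "h \<in> dil_lattice P 3" using irr d4 by simp
      then obtain a where a: "\<forall>j<3. a j \<in> dil_lattice P 1" "h = (\<Sum>j<3::nat. a j)"
        using * by (metis one_le_numeral)
      have "a 0 \<in> dil_lattice P 1" "a 1 \<in> dil_lattice P 1" "a 2 \<in> dil_lattice P 1" using a by auto
      moreover from this have "a 1 + a 2 \<in> dil_lattice P (1 + 1)" by (intro dil_lattice_add P)
      moreover have "h - a 0 = a 1 + a 2" using a by (simp add: numeral_3_eq_3 numeral_2_eq_2)
      ultimately have "reducible P (d - 1) h"
        unfolding reducible_def using d4 by (intro exI[of _ 1] exI[of _ "a 0"]) (auto simp: numeral_2_eq_2)
      then show False using irr by simp
    qed
  qed
  show "mu_midp P = d - 2" unfolding mu_midp_def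
  proof (rule Least_equality)
    show "0 < d - 2 \<and> IDP (dilate (d - 2) P)" using d main by simp
    show "d - 2 \<le> k" if "0 < k \<and> IDP (dilate k P)" for k
      by (rule ccontr) (use small[of k] that in auto)
  qed
  show "mu_idp P = d - 2" unfolding mu_idp_def
  proof (rule Least_equality)
    have "IDP (dilate n P)" if "d - 2 \<le> n" for n
      using main big[of n] that by (cases "n = d - 2") auto
    then show "0 < d - 2 \<and> (\<forall>n\<ge>d - 2. IDP (dilate n P))" using d by simp
    show "d - 2 \<le> k" if "0 < k \<and> (\<forall>n\<ge>k. IDP (dilate n P))" for k
      by (rule ccontr) (use small[of k] that in auto)
  qed
qed

subsection \<open>The prism as an integral polytope\<close>

lemma standard_simplex_eq:
  "convex hull (range (\<lambda>i. axis i 1)) = {x :: real^'n. (\<forall>i. 0 \<le> x $ i) \<and> (\<Sum>i\<in>UNIV. x $ i) = 1}"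
    (is "_ = ?S")
proof
  have "convex ?S"
    by (auto simp: convex_def sum.distrib simp flip: sum_distrib_left)
  moreover have "range (\<lambda>i. axis i 1) \<subseteq> ?S" by (auto simp: axis_def)
  ultimately show "convex hull (range (\<lambda>i. axis i 1)) \<subseteq> ?S" by (intro hull_minimal)
  show "?S \<subseteq> convex hull (range (\<lambda>i. axis i 1))"
  proof
    fix x :: "real^'n" assume x: "x \<in> ?S"
    have "(\<Sum>i\<in>UNIV. x $ i *\<^sub>R axis i 1) \<in> convex hull (range (\<lambda>i. axis i (1::real)))"
      using x by (intro convex_sum) (auto intro: hull_inc)
    moreover have "(\<Sum>i\<in>UNIV. x $ i *\<^sub>R axis i 1) = x"
      using basis_expansion[of x] by (simp add: scalar_mult_eq_scaleR)
    ultimately show "x \<in> convex hull (range (\<lambda>i. axis i 1))" by simp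
  qed
qed

context skew_prism
begin

text \<open>Integral coordinates on the lattice of \<open>S\<close>: \<open>lin\<close> sends the barycentric coordinates and the height
  (both divided by \<open>N\<close>) of a point to coordinates in which the lattice is the integer lattice.\<close>

definition lin :: "(real^'n) \<times> real \<Rightarrow> real^'n" where
  "lin z = (\<chi> i. if i = ib then of_int N * snd z
     else if i = ia then of_int p * (fst z $ ia + of_int (T ia) * snd z)
     else fst z $ i - of_int (\<alpha> i) * (fst z $ ia + of_int (T ia) * snd z) + of_int (T i) * snd z)"

definition prism :: "(real^'n) set" where
  "prism = convex hull (lin ` (range (\<lambda>i. axis i 1) \<times> {0, 1}))"

definition emb :: "('n \<Rightarrow> int) \<Rightarrow> int \<Rightarrow> real^'n" where
  "emb \<sigma> u = lin (\<chi> i. \<sigma> i / N, u / N)"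

lemma linear_lin: "linear lin"
  by (rule linearI) (auto simp: lin_def vec_eq_iff algebra_simps)

lemma prism_eq: "prism = lin ` ({x. (\<forall>i. 0 \<le> x $ i) \<and> (\<Sum>i\<in>UNIV. x $ i) = 1} \<times> {0..1})"
proof -
  have "convex hull {0, 1::real} = {0..1}"
    by (simp add: closed_segment_eq_real_ivl flip: segment_convex_hull)
  then show ?thesis
    by (simp add: prism_def convex_hull_Times standard_simplex_eq
        flip: convex_hull_linear_image[OF linear_lin])
qed

lemma integral_polytope_prism: "integral_polytope prism"
proof -
  let ?V = "lin ` (range (\<lambda>i. axis i 1) \<times> {0, 1})"
  have "finite ?V" by simp
  moreover have "?V \<subseteq> lattice_pts"
    by (auto simp: lattice_pts_def lin_def axis_def)
  ultimately show ?thesis unfolding integral_polytope_def prism_def by blast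
qed

lemma prism_props: "compact prism" "convex prism" "prism \<noteq> {}"
  unfolding prism_def by (auto intro: finite_imp_compact_convex_hull)

text \<open>The lower vertex over \<open>ib\<close> is the origin, so the affine dimension is that
  of the span. The unit vectors are recovered by elimination: first those of the other indices, then
  \<open>ia\<close>, then \<open>ib\<close>.\<close>

lemma aff_dim_prism: "aff_dim prism = int d"
proof -
  have v_in: "lin (axis i 1, w) \<in> span prism" if "w = 0 \<or> w = 1" for i w
    using that unfolding prism_def by (intro span_base hull_inc) auto
  have single: "axis i 1 \<in> span prism" if "i \<noteq> ia" "i \<noteq> ib" for i
  proof -
    have "lin (axis i 1, 0) = axis i 1" using that by (auto simp: lin_def axis_def vec_eq_iff)
    then show ?thesis using v_in[of 0 i] by simp
  qed
  have recover: "axis k 1 \<in> span prism"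
    if v: "v \<in> span prism" and k: "v $ k \<noteq> 0" and
      others: "\<And>j. j \<noteq> k \<Longrightarrow> v $ j \<noteq> 0 \<Longrightarrow> axis j 1 \<in> span prism" for v k
  proof -
    have "(\<Sum>j\<in>UNIV. v $ j *\<^sub>R axis j 1) = v"
      using basis_expansion[of v] by (simp add: scalar_mult_eq_scaleR)
    then have eq: "v = v $ k *\<^sub>R axis k 1 + (\<Sum>j\<in>UNIV - {k}. v $ j *\<^sub>R axis j 1)"
      by (simp add: sum.remove[of UNIV k])
    have "(\<Sum>j\<in>UNIV - {k}. v $ j *\<^sub>R axis j 1) \<in> span prism"
    proof (rule span_sum)
      fix j assume "j \<in> UNIV - {k}"
      then show "v $ j *\<^sub>R axis j 1 \<in> span prism"
        using others[of j] by (cases "v $ j = 0") (auto intro: span_scale span_zero)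
    qed
    moreover have "v $ k *\<^sub>R axis k 1 = v - (\<Sum>j\<in>UNIV - {k}. v $ j *\<^sub>R axis j 1)"
      using eq[symmetric] by (simp only: eq_diff_eq)
    ultimately have "v $ k *\<^sub>R axis k 1 \<in> span prism" using v by (simp only: span_diff)
    then have "inverse (v $ k) *\<^sub>R (v $ k *\<^sub>R axis k 1) \<in> span prism" by (rule span_scale)
    then show ?thesis using k by simp
  qed
  have ia: "axis ia 1 \<in> span prism"
  proof (rule recover)
    show "lin (axis ia 1, 0) \<in> span prism" by (simp add: v_in)
    show "lin (axis ia 1, 0) $ ia \<noteq> 0" using p_pos ia_ib by (simp add: lin_def axis_def)
    have "lin (axis ia 1, 0) $ ib = 0" by (simp add: lin_def)
    then show "axis j 1 \<in> span prism" if "j \<noteq> ia" "lin (axis ia 1, 0) $ j \<noteq> 0" for j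
      using that single[of j] by auto
  qed
  have ib: "axis ib 1 \<in> span prism"
  proof (rule recover)
    show "lin (axis ib 1, 1) \<in> span prism" by (simp add: v_in)
    show "lin (axis ib 1, 1) $ ib \<noteq> 0" using N_pos by (simp add: lin_def)
    show "axis j 1 \<in> span prism" if "j \<noteq> ib" for j
      using that single[of j] ia by auto
  qed
  have "axis i 1 \<in> span prism" for i using ia ib single by metis
  then have "x \<in> span prism" for x :: "real^'n"
  proof -
    have "(\<Sum>j\<in>UNIV. x $ j *\<^sub>R axis j 1) \<in> span prism"
      using \<open>\<And>i. axis i 1 \<in> span prism\<close> by (intro span_sum span_scale)
    then show ?thesis using basis_expansion[of x] by (simp add: scalar_mult_eq_scaleR)
  qed
  then have "span prism = UNIV" by blast
  then have "dim prism = d" by (metis dim_UNIV dim_span DIM_cart DIM_real mult.right_neutral d_def)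
  moreover have "lin (axis ib 1, 0) = 0" using ia_ib by (auto simp: lin_def axis_def vec_eq_iff)
  then have "0 \<in> prism" unfolding prism_def by (intro hull_inc) (metis UNIV_I SigmaI image_eqI insertI1)
  ultimately show ?thesis using aff_dim_zero[of prism] hull_inc[of 0 prism affine] by simp
qed

section \<open>Lattice points of the dilates as elements of \<open>S\<close>\<close>

lemma emb_add: "emb (\<lambda>i. \<sigma> i + \<sigma>' i) (u + u') = emb \<sigma> u + emb \<sigma>' u'"
  by (auto simp: emb_def lin_def vec_eq_iff algebra_simps add_divide_distrib)

lemma emb_diff: "emb (\<lambda>i. \<sigma> i - \<sigma>' i) (u - u') = emb \<sigma> u - emb \<sigma>' u'"
  by (auto simp: emb_def lin_def vec_eq_iff algebra_simps diff_divide_distrib)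

lemma emb_sum:
  fixes n :: nat
  shows "(\<Sum>j<n. emb (\<sigma> j) (u j)) = emb (\<lambda>i. \<Sum>j<n. \<sigma> j i) (\<Sum>j<n. u j)"
proof (induction n)
  case 0
  show ?case by (simp add: emb_def lin_def vec_eq_iff)
next
  case (Suc n)
  then show ?case by (simp add: emb_add)
qed

text \<open>\<open>lin\<close> drops the barycentric coordinate at \<open>ib\<close>; the equal sums
  recover it.\<close>

lemma emb_inj:
  assumes eq: "emb \<sigma> u = emb \<sigma>' u'" and sums: "sum \<sigma> UNIV = sum \<sigma>' UNIV"
  shows "u = u'" "\<sigma> = \<sigma>'"
proof -
  have N0: "real_of_int N \<noteq> 0" using N_pos by simp
  have comp: "emb \<sigma> u $ i = emb \<sigma>' u' $ i" for i using eq by simp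
  show u: "u = u'" using comp[of ib] N0 by (simp add: emb_def lin_def)
  have ia: "\<sigma> ia = \<sigma>' ia" using comp[of ia] N0 p_pos ia_ib u by (simp add: emb_def lin_def)
  have other: "\<sigma> i = \<sigma>' i" if "i \<noteq> ia" "i \<noteq> ib" for i
    using comp[of i] N0 that u ia by (simp add: emb_def lin_def)
  have "sum \<sigma> (UNIV - {ia, ib}) = sum \<sigma>' (UNIV - {ia, ib})" using other by (intro sum.cong) auto
  then have "\<sigma> ib = \<sigma>' ib" using sums ia by (simp add: sum_split)
  then show "\<sigma> = \<sigma>'" using ia other by (metis ext)
qed

lemma dilate_prism:
  "dilate n prism = lin ` {(x, w). (\<forall>i. 0 \<le> x $ i) \<and> (\<Sum>i\<in>UNIV. x $ i) = real n \<and> 0 \<le> w \<and> w \<le> real n}"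
    (is "_ = lin ` ?K")
proof
  show "dilate n prism \<subseteq> lin ` ?K"
  proof
    fix v assume "v \<in> dilate n prism"
    then obtain x w where x: "v = real n *\<^sub>R lin (x, w)" "\<forall>i. 0 \<le> x $ i" "(\<Sum>i\<in>UNIV. x $ i) = 1" "0 \<le> w" "w \<le> 1"
      unfolding dilate_def prism_eq by fastforce
    have "v = lin (real n *\<^sub>R x, real n * w)" using x(1) linear_scale[OF linear_lin, of "real n" "(x, w)"] by simp
    moreover have "(real n *\<^sub>R x, real n * w) \<in> ?K"
      using x by (auto simp: mult_left_le simp flip: sum_distrib_left)
    ultimately show "v \<in> lin ` ?K" by blast
  qed
  show "lin ` ?K \<subseteq> dilate n prism"
  proof clarify
    fix x :: "real^'n" and w
    assume x: "\<forall>i. 0 \<le> x $ i" "(\<Sum>i\<in>UNIV. x $ i) = real n" "0 \<le> w" "w \<le> real n"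
    show "lin (x, w) \<in> dilate n prism"
    proof (cases "n = 0")
      case True
      then have "x $ i = 0" for i using x by (simp add: sum_nonneg_eq_0_iff)
      then have "x = 0" "w = 0" using x True by (auto simp: vec_eq_iff)
      then have "lin (x, w) = 0" using linear_0[OF linear_lin] by (simp add: zero_prod_def)
      then show ?thesis using True prism_props(3) by (auto simp: dilate_def)
    next
      case False
      have "lin ((1 / real n) *\<^sub>R x, w / real n) \<in> prism"
        unfolding prism_eq using x False by (intro imageI) (auto simp flip: sum_divide_distrib)
      moreover have "lin (x, w) = real n *\<^sub>R lin ((1 / real n) *\<^sub>R x, w / real n)"
        using linear_scale[OF linear_lin, of "real n" "((1 / real n) *\<^sub>R x, w / real n)"] False by simp
      ultimately show ?thesis by (auto simp: dilate_def)
    qed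
  qed
qed

lemma dil_lattice_emb:
  assumes S: "S n \<sigma> u"
  shows "emb \<sigma> u \<in> dil_lattice prism n"
proof -
  have N0: "real_of_int N > 0" using N_pos by simp
  have "(\<Sum>i\<in>UNIV. real_of_int (\<sigma> i) / N) = real_of_int (sum \<sigma> UNIV) / N" by (simp add: sum_divide_distrib)
  also have "\<dots> = real n" using S N0 by (simp add: S_def)
  finally have 1: "(\<Sum>i\<in>UNIV. real_of_int (\<sigma> i) / N) = real n" .
  have "real_of_int u \<le> real_of_int (N * int n)" using S unfolding S_def by (simp only: of_int_le_iff)
  then have 2: "u / N \<le> real n" using N0 by (simp add: field_simps)
  have "emb \<sigma> u \<in> dilate n prism"
    unfolding dilate_prism emb_def using S N0 1 2 by (intro imageI) (auto simp: S_def)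
  obtain g where g: "\<And>i. N dvd \<sigma> i - D * \<alpha> i * g + u * T i" using S unfolding S_def by blast
  have "D dvd \<sigma> ia - D * \<alpha> ia * g + u * T ia" using g[of ia] unfolding N_def by (rule dvd_mult_left)
  then have "D dvd (\<sigma> ia - D * \<alpha> ia * g + u * T ia) + D * g" by (rule dvd_add[OF _ dvd_triv_left])
  \<comment> \<open>\<open>G\<close> is the \<open>ia\<close> coordinate of the image and agrees
    with the class \<open>g\<close> modulo \<open>p\<close>, so it can replace \<open>g\<close> in
    the other conditions.\<close>
  then obtain G where G: "\<sigma> ia + u * T ia = D * G" by (auto simp: alpha_ia)
  have "D * p dvd D * (G - g)" using g[of ia] G by (simp add: alpha_ia N_def algebra_simps)
  then have pG: "p dvd G - g" using D_pos by simp
  have "emb \<sigma> u $ i \<in> \<int>" for i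
  proof -
    consider "i = ib" | "i = ia" | "i \<noteq> ia" "i \<noteq> ib" by blast
    then show ?thesis
    proof cases
      case 1 then show ?thesis using N0 by (simp add: emb_def lin_def)
    next
      case 2
      have "emb \<sigma> u $ ia = p * ((\<sigma> ia + u * T ia) / N)"
        using ia_ib by (simp add: emb_def lin_def add_divide_distrib mult.commute)
      also have "\<dots> = real_of_int G"
        using N0 D_pos p_pos arg_cong[OF G, of real_of_int] by (simp add: N_def)
      finally show ?thesis using 2 by simp
    next
      case 3
      have "N dvd (\<sigma> i - D * \<alpha> i * g + u * T i) - D * \<alpha> i * (G - g)"
        using g[of i] pG by (intro dvd_diff) (auto simp: N_def mult_dvd_mono)
      then have "N dvd \<sigma> i - \<alpha> i * (D * G) + u * T i" by (simp add: algebra_simps)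
      then obtain q where q: "\<sigma> i - \<alpha> i * (D * G) + u * T i = N * q" by blast
      have "emb \<sigma> u $ i = (\<sigma> i - \<alpha> i * (\<sigma> ia + u * T ia) + u * T i) / N"
        using 3 by (simp add: emb_def lin_def add_divide_distrib diff_divide_distrib algebra_simps)
      also have "\<dots> = real_of_int (\<sigma> i - \<alpha> i * (D * G) + u * T i) / N"
        using arg_cong[OF G, of real_of_int] by simp
      also have "\<dots> = real_of_int q" unfolding q using N0 by simp
      finally show ?thesis by simp
    qed
  qed
  then show ?thesis using \<open>emb \<sigma> u \<in> dilate n prism\<close> by (simp add: dil_lattice_def lattice_pts_def)
qed

lemma dil_latticeE:
  assumes "v \<in> dil_lattice prism n"
  obtains \<sigma> u where "S n \<sigma> u" "v = emb \<sigma> u"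
proof -
  have N0: "real_of_int N > 0" using N_pos by simp
  obtain x w where v: "v = lin (x, w)" and x: "\<And>i. 0 \<le> x $ i" "(\<Sum>i\<in>UNIV. x $ i) = real n" "0 \<le> w" "w \<le> real n"
    and lat: "\<And>i. v $ i \<in> \<int>"
    using assms by (auto simp: dil_lattice_def dilate_prism lattice_pts_def)
  define z where "z = (\<lambda>i. \<lfloor>v $ i\<rfloor>)"
  have z: "v $ i = real_of_int (z i)" for i using lat[of i] by (simp add: z_def)
  \<comment> \<open>\<open>lin\<close> is inverted after scaling by \<open>N\<close>:
    \<open>z ia\<close> becomes the class and \<open>z ib\<close> the height.\<close>
  define \<sigma>0 where "\<sigma>0 = (\<lambda>i. if i = ia then D * z ia - T ia * z ib
      else N * z i + D * \<alpha> i * z ia - T i * z ib)"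
  define \<sigma> where "\<sigma> = (\<lambda>i. if i = ib then N * int n - sum \<sigma>0 (UNIV - {ib}) else \<sigma>0 i)"
  have w: "N * w = z ib" using z[of ib] by (simp add: v lin_def)
  have xa: "p * (x $ ia + T ia * w) = z ia" using z[of ia] ia_ib by (simp add: v lin_def)
  have "N * (x $ ia + T ia * w) = D * z ia" using xa by (simp add: N_def mult.assoc)
  then have xia: "N * x $ ia = D * z ia - T ia * z ib" using w by (simp add: algebra_simps flip: w)
  have Nx0: "N * x $ i = \<sigma>0 i" if "i \<noteq> ib" for i
  proof (cases "i = ia")
    case True then show ?thesis using xia by (simp add: \<sigma>0_def)
  next
    case False
    have "x $ i - \<alpha> i * (x $ ia + T ia * w) + T i * w = z i" using z[of i] that False by (simp add: v lin_def)
    then have "N * (x $ i - \<alpha> i * (x $ ia + T ia * w) + T i * w) = N * z i" by simp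
    then have "N * x $ i = N * z i + \<alpha> i * (N * (x $ ia + T ia * w)) - T i * (N * w)"
      by (simp add: algebra_simps)
    also have "\<dots> = N * z i + \<alpha> i * (D * z ia) - T i * z ib"
      unfolding \<open>N * (x $ ia + T ia * w) = D * z ia\<close> w by simp
    finally show ?thesis using False by (simp add: \<sigma>0_def algebra_simps)
  qed
  have Nx: "N * x $ i = \<sigma> i" for i
  proof (cases "i = ib")
    case True
    have "real n = x $ ib + (\<Sum>i\<in>UNIV - {ib}. x $ i)" using x(2) by (simp add: sum.remove[of UNIV ib])
    then have "N * x $ ib = N * real n - (\<Sum>i\<in>UNIV - {ib}. N * x $ i)"
      by (simp add: algebra_simps sum_distrib_left)
    also have "(\<Sum>i\<in>UNIV - {ib}. N * x $ i) = (\<Sum>i\<in>UNIV - {ib}. real_of_int (\<sigma>0 i))"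
      using Nx0 by (intro sum.cong) auto
    finally show ?thesis using True by (simp add: \<sigma>_def)
  next
    case False then show ?thesis using Nx0 by (simp add: \<sigma>_def)
  qed
  have x_eq: "x = (\<chi> i. \<sigma> i / N)" using Nx N0 by (simp add: vec_eq_iff field_simps)
  have w_eq: "w = z ib / N" using w N0 by (simp add: field_simps)
  have sum\<sigma>: "sum \<sigma> UNIV = N * int n"
  proof -
    have "sum \<sigma> (UNIV - {ib}) = sum \<sigma>0 (UNIV - {ib})" by (rule sum.cong) (auto simp: \<sigma>_def)
    then show ?thesis by (simp add: sum.remove[of UNIV ib] \<sigma>_def)
  qed
  have other: "N dvd \<sigma> i - D * \<alpha> i * z ia + z ib * T i" if "i \<noteq> ib" for i
    using that by (auto simp: \<sigma>_def \<sigma>0_def alpha_ia algebra_simps)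
  have "S n \<sigma> (z ib)"
  proof (rule S_intro[where g = "z ia"])
    show "N dvd \<sigma> i - D * \<alpha> i * z ia + z ib * T i" for i
    proof (cases "i = ib")
      case True
      \<comment> \<open>The condition at \<open>ib\<close> follows from the others, as all the
        left-hand sides together add up to a multiple of \<open>N\<close>.\<close>
      let ?f = "\<lambda>i. \<sigma> i - D * \<alpha> i * z ia + z ib * T i"
      have "sum ?f UNIV = N * int n - D * sum \<alpha> UNIV * z ia + z ib * N"
        by (simp add: sum.distrib sum_subtractf sum\<sigma> flip: sum_distrib_left sum_distrib_right sum_T)
      moreover have "N dvd D * sum \<alpha> UNIV * z ia" using alpha_sum by (simp add: N_def mult_dvd_mono dvd_mult2)
      ultimately have all: "N dvd sum ?f UNIV" by (simp add: dvd_diff)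
      have rest: "N dvd sum ?f (UNIV - {ib})" using other by (intro dvd_sum) auto
      have "sum ?f UNIV = ?f ib + sum ?f (UNIV - {ib})" by (rule sum.remove) auto
      then have "?f ib = sum ?f UNIV - sum ?f (UNIV - {ib})" by linarith
      then show ?thesis using True dvd_diff[OF all rest] by (simp only:)
    next
      case False then show ?thesis using other by simp
    qed
    show "0 \<le> \<sigma> i" for i
    proof -
      have "0 \<le> N * x $ i" using N0 x(1)[of i] by simp
      then show ?thesis unfolding Nx by simp
    qed
    show "0 \<le> z ib" using w N0 x(3) by (metis mult_nonneg_nonneg of_int_0_le_iff order_less_imp_le)
    have "N * w \<le> N * real n" using N0 x(4) by (intro mult_left_mono) auto
    then have "real_of_int (z ib) \<le> real_of_int (N * int n)" using w by simp
    then show "z ib \<le> N * int n" by (simp only: of_int_le_iff)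
  qed (fact sum\<sigma>)
  moreover have "v = emb \<sigma> (z ib)" unfolding emb_def v x_eq[symmetric] w_eq[symmetric] by (rule refl)
  ultimately show thesis by (rule that)
qed

lemma not_IDP_dilate_prism:
  assumes "p dvd T ib" "coprime (T ib) D" "(int d - 2) * (int d + 1) * t < p" and k: "1 \<le> k" "k < d - 2"
  shows "\<not> IDP (dilate k prism)"
proof
  assume "IDP (dilate k prism)"
  \<comment> \<open>The number of vertices that raises the degree of \<open>corner\<close> from
    \<open>d - 2\<close> to \<open>(d - 2) * k\<close>.\<close>
  define m where "m = (d - 2) * (k - 1)"
  have deg: "d - 2 + m = (d - 2) * k" using k by (cases k) (auto simp: m_def)
  have S: "S (d - 2 + m) (\<lambda>i. corner i + int m * vert ia i) D"
    using assms by (intro S_corner_plus)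
  then have "emb (\<lambda>i. corner i + int m * vert ia i) D \<in> dil_lattice prism ((d - 2) * k)"
    using dil_lattice_emb[OF S] deg by simp
  moreover have "1 \<le> d - 2" using d4 by simp
  ultimately obtain a where a: "\<And>j. j < d - 2 \<Longrightarrow> a j \<in> dil_lattice prism k"
      "emb (\<lambda>i. corner i + int m * vert ia i) D = (\<Sum>j<d - 2. a j)"
    using \<open>IDP (dilate k prism)\<close>[unfolded IDP_dilate_iff] by blast
  have "\<exists>\<sigma> u. S k \<sigma> u \<and> a j = emb \<sigma> u" if j: "j < d - 2" for j
    by (rule dil_latticeE[OF a(1)[OF j]]) blast
  then obtain \<sigma> u where \<sigma>: "\<And>j. j < d - 2 \<Longrightarrow> S k (\<sigma> j) (u j) \<and> a j = emb (\<sigma> j) (u j)" by metis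
  have "(\<Sum>j<d - 2. a j) = emb (\<lambda>i. \<Sum>j<d - 2. \<sigma> j i) (\<Sum>j<d - 2. u j)"
    using \<sigma> by (simp flip: emb_sum)
  moreover have "(\<Sum>i\<in>UNIV. \<Sum>j<d - 2. \<sigma> j i) = (\<Sum>j<d - 2. \<Sum>i\<in>UNIV. \<sigma> j i)" by (rule sum.swap)
  then have "(\<Sum>i\<in>UNIV. \<Sum>j<d - 2. \<sigma> j i) = N * int ((d - 2) * k)"
    using \<sigma> by (simp add: S_def)
  then have "(\<Sum>i\<in>UNIV. corner i + int m * vert ia i) = (\<Sum>i\<in>UNIV. \<Sum>j<d - 2. \<sigma> j i)"
    using S deg by (simp add: S_def)
  ultimately have eq: "D = (\<Sum>j<d - 2. u j)" "(\<lambda>i. corner i + int m * vert ia i) = (\<lambda>i. \<Sum>j<d - 2. \<sigma> j i)"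
    using a(2) emb_inj[of "\<lambda>i. corner i + int m * vert ia i" D "\<lambda>i. \<Sum>j<d - 2. \<sigma> j i" "\<Sum>j<d - 2. u j"]
    by simp_all
  show False
  proof (rule corner_plus_not_sum[OF assms(1-3) _ k(2)])
    show "S k (\<sigma> j) (u j)" if "j < d - 2" for j using \<sigma>[OF that] by blast
    show "(\<Sum>j<d - 2. \<sigma> j i) = corner i + int m * vert ia i" for i using fun_cong[OF eq(2), of i] by simp
    show "(\<Sum>j<d - 2. u j) = D" using eq(1) by simp
  qed
qed

lemma mu_prism:
  assumes "5 \<le> d \<Longrightarrow> p dvd T ib" "5 \<le> d \<Longrightarrow> coprime (T ib) D"
    "5 \<le> d \<Longrightarrow> (int d - 2) * (int d + 1) * t < p"
  shows "mu_Hilb prism = real (d - 1)" "mu_midp prism = d - 2" "mu_idp prism = d - 2"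
proof -
  have unit: "\<exists>x\<in>dil_lattice prism 1. v - x \<in> dil_lattice prism n"
    if n: "d \<le> Suc n" and v: "v \<in> dil_lattice prism (Suc n)" for n v
  proof -
    obtain \<sigma> u where \<sigma>: "S (Suc n) \<sigma> u" "v = emb \<sigma> u" using v by (rule dil_latticeE)
    obtain i where i: "N \<le> \<sigma> i" using big_coordinate[OF \<sigma>(1) n] .
    have "1 \<le> n" using n d4 by simp
    obtain w where w: "S 1 (vert i) w" "S n (\<lambda>j. \<sigma> j - vert i j) (u - w)"
      using subtract_vertex[OF \<sigma>(1) \<open>1 \<le> n\<close> i] .
    show ?thesis
      using dil_lattice_emb[OF w(1)] dil_lattice_emb[OF w(2)] \<sigma>(2) by (auto simp: emb_diff)
  qed
  have mid: "\<exists>j x. 2 \<le> j \<and> j \<le> d - 2 \<and> x \<in> dil_lattice prism j \<and> v - x \<in> dil_lattice prism (d - j)"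
    if v: "v \<in> dil_lattice prism d" for v
  proof -
    obtain \<sigma> u where \<sigma>: "S d \<sigma> u" "v = emb \<sigma> u" using v by (rule dil_latticeE)
    obtain j where j: "2 \<le> j" "j \<le> d - 2" "decomp j (d - j) \<sigma> u" using degree_d_decomposes[OF \<sigma>(1)] .
    then obtain \<sigma>' u' where "S j \<sigma>' u'" "S (d - j) (\<lambda>i. \<sigma> i - \<sigma>' i) (u - u')" by (auto simp: decomp_def)
    then have "emb \<sigma>' u' \<in> dil_lattice prism j" "v - emb \<sigma>' u' \<in> dil_lattice prism (d - j)"
      using dil_lattice_emb by (auto simp: \<sigma>(2) simp flip: emb_diff)
    then show ?thesis using j by blast
  qed
  have h: "emb (\<lambda>i. N - T i) 1 \<in> dil_lattice prism (d - 1)" by (rule dil_lattice_emb[OF S_irreducible_point])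
  have irr: "\<not> reducible prism (d - 1) (emb (\<lambda>i. N - T i) 1)"
  proof
    assume "reducible prism (d - 1) (emb (\<lambda>i. N - T i) 1)"
    then obtain j x where j: "1 \<le> j" "j < d - 1" "x \<in> dil_lattice prism j"
        "emb (\<lambda>i. N - T i) 1 - x \<in> dil_lattice prism (d - 1 - j)" by (auto simp: reducible_def)
    obtain \<sigma> u where \<sigma>: "S j \<sigma> u" "x = emb \<sigma> u" using j(3) by (rule dil_latticeE)
    obtain \<sigma>' u' where \<sigma>': "S (d - 1 - j) \<sigma>' u'" "emb (\<lambda>i. N - T i) 1 - x = emb \<sigma>' u'"
      using j(4) by (rule dil_latticeE)
    have "emb (\<lambda>i. \<sigma> i + \<sigma>' i) (u + u') = emb (\<lambda>i. N - T i) 1"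
      using \<sigma>(2) \<sigma>'(2) by (simp add: emb_add algebra_simps)
    moreover have "S (j + (d - 1 - j)) (\<lambda>i. \<sigma> i + \<sigma>' i) (u + u')" by (rule S_add[OF \<sigma>(1) \<sigma>'(1)])
    then have "(\<Sum>i\<in>UNIV. \<sigma> i + \<sigma>' i) = (\<Sum>i\<in>UNIV. N - T i)" using S_irreducible_point j(2) by (simp add: S_def)
    ultimately have "u + u' = 1" "(\<lambda>i. \<sigma> i + \<sigma>' i) = (\<lambda>i. N - T i)" by (rule emb_inj)+
    moreover have "1 \<le> d - 1 - j" using j(2) by simp
    ultimately show False using irreducible_point[OF \<sigma>(1) \<sigma>'(1) j(1)] by (simp add: fun_eq_iff)
  qed
  have bad: "\<not> IDP (dilate k prism)" if "5 \<le> d" "1 \<le> k" "k < d - 2" for k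
    using not_IDP_dilate_prism assms that by blast
  show "mu_Hilb prism = real (d - 1)" "mu_midp prism = d - 2" "mu_idp prism = d - 2"
    using mu_values[OF prism_props d4 unit mid h irr bad] by auto
qed

end

theorem theorem2p6:
  fixes d :: nat
  assumes "d \<ge> 4" and "CARD('n::finite) = d"
  shows "\<exists>P :: (real^'n) set. integral_polytope P \<and> aff_dim P = int d \<and>
           mu_Hilb P = real (d - 1) \<and>
           mu_midp P = d - 2 \<and> mu_idp P = d - 2"
proof -
  obtain p s t r :: int and \<beta> :: "nat \<Rightarrow> int" where
    par: "1 \<le> s" "s + int d \<le> p" "1 \<le> t" "0 \<le> r" "int d * r < t"
      "\<forall>j<d - 2. p dvd \<beta> j * (s + 1 + int j) + 1" "p dvd (\<Sum>j<d - 2. \<beta> j)"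
      "d \<ge> 5 \<longrightarrow> p dvd (int d * s + 1) * t + r \<and>
         coprime ((int d * s + 1) * t + r) (int d * t) \<and> (int d - 2) * (int d + 1) * t < p"
    by (rule prism_parameters_exist[OF assms(1)])
  obtain f :: "'n \<Rightarrow> nat" where f: "bij_betw f UNIV {..<d}"
    using ex_bij_betw_finite_nat[of "UNIV :: 'n set"] assms(2) by (auto simp: atLeast0LessThan)
  \<comment> \<open>With \<open>ia\<close> and \<open>ib\<close> in the last two places,
    \<open>f\<close> numbers the remaining indices from \<open>0\<close> to
    \<open>d - 3\<close>.\<close>
  have "d - 1 \<in> range f" "d - 2 \<in> range f" using bij_betw_imp_surj_on[OF f] assms(1) by auto
  then obtain ia ib where ia: "f ia = d - 1" and ib: "f ib = d - 2" by (metis rangeE)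
  have "ia \<noteq> ib" using ia ib assms(1) by auto
  have "bij_betw f (UNIV - {ia, ib}) ({..<d} - {d - 1, d - 2})"
    using bij_betw_subset[OF f, of "UNIV - {ia, ib}"] f ia ib
    by (simp add: bij_betw_def image_set_diff)
  moreover have "{..<d} - {d - 1, d - 2} = {..<d - 2}" using assms(1) by auto
  ultimately have pos: "bij_betw f (UNIV - {ia, ib}) {..<d - 2}" by simp
  define \<alpha> where "\<alpha> = (\<lambda>i. if i = ia then 1 else if i = ib then - 1 else \<beta> (f i))"
  have "sum \<alpha> UNIV = \<alpha> ia + (\<alpha> ib + sum \<alpha> (UNIV - {ia} - {ib}))"
    using \<open>ia \<noteq> ib\<close> by (simp add: sum.remove[of UNIV ia] sum.remove[of "UNIV - {ia}" ib])
  also have "\<dots> = sum \<alpha> (UNIV - {ia, ib})"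
    using \<open>ia \<noteq> ib\<close> by (simp add: \<alpha>_def Diff_insert2[symmetric] insert_commute)
  also have "\<dots> = (\<Sum>i\<in>UNIV - {ia, ib}. \<beta> (f i))" by (rule sum.cong) (auto simp: \<alpha>_def)
  also have "\<dots> = (\<Sum>j<d - 2. \<beta> j)" by (rule sum.reindex_bij_betw[OF pos])
  finally have "p dvd sum \<alpha> UNIV" using par(7) by simp
  moreover have "p dvd \<alpha> i * (s + 1 + int (f i)) + 1" if "i \<noteq> ia" "i \<noteq> ib" for i
  proof -
    have "f i < d - 2" using pos that unfolding bij_betw_def by auto
    then show ?thesis using par(6) that by (simp add: \<alpha>_def)
  qed
  ultimately interpret Pr: skew_prism ia ib f \<alpha> p s t r
    using assms par(1-5) pos \<open>ia \<noteq> ib\<close> by unfold_locales (auto simp: \<alpha>_def)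
  have d: "Pr.d = d" using assms(2) by (simp add: Pr.d_def)
  have T: "Pr.T ib = (int d * s + 1) * t + r" "Pr.D = int d * t"
    using \<open>ia \<noteq> ib\<close> by (simp_all add: Pr.T_def Pr.c_def Pr.e_def Pr.D_def d algebra_simps)
  have "mu_Hilb Pr.prism = real (d - 1)" "mu_midp Pr.prism = d - 2" "mu_idp Pr.prism = d - 2"
    using Pr.mu_prism par(8) unfolding d T by blast+
  then show ?thesis using Pr.integral_polytope_prism Pr.aff_dim_prism d by auto
qed

end
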